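(* Let $\mathfrak{H}$ be a complex Hilbert space, let $\mathfrak{a}$ be a symmetric sesquilinear form with dense domain $\mathrm{Dom}[\mathfrak{a}]\subset\mathfrak{H}$, and let $J$ be a self-adjoint involution on $\mathfrak{H}$ such that $J\,\mathrm{Dom}[\mathfrak{a}]=\mathrm{Dom}[\mathfrak{a}]$ and $\mathfrak{a}[Jx,y]=\mathfrak{a}[x,Jy]$ for all $x,y\in\mathrm{Dom}[\mathfrak{a}]$. Suppose that the form $\mathfrak{a}_J[x,y]:=\mathfrak{a}[x,Jy]$, $x,y\in\mathrm{Dom}[\mathfrak{a}_J]=\mathrm{Dom}[\mathfrak{a}]$, is a positive definite closed form. Put $\mathfrak{H}_\pm=\mathrm{Ran}(I\pm J)$ and let $m_\pm$ be the greatest lower bound of $\mathfrak{a}_J$ restricted to $\mathfrak{H}_\pm$. Let $\mathfrak{v}$ be an $\mathfrak{a}$-bounded symmetric sesquilinear form that is off-diagonal with respect to the orthogonal decomposition $\mathfrak{H}=\mathfrak{H}_+\oplus\mathfrak{H}_-$. Let $A$ be the unique self-adjoint operator associated with the form $\mathfrak{a}$ and $B$ the unique self-adjoint operator associated with the form $\mathfrak{b}=\mathfrak{a}+\mathfrak{v}$ on $\mathrm{Dom}[\mathfrak{b}]=\mathrm{Dom}[\mathfrak{a}]$. Then the norm of the difference of the spectral projections $P=\mathsf{E}_A(\mathbb{R}_+)$ and $Q=\mathsf{E}_B(\mathbb{R}_+)$ satisfies $$\|P-Q\|\le\sin\left(\tfrac12\arctan v\right)<\frac{\sqrt2}{2},$$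 where $$v=\inf_{\mu\in(-m_-,m_+)}v_\mu=\inf_{\mu\in(-m_-,m_+)}\ \sup_{0\ne x\in\mathrm{Dom}[\mathfrak{a}]}\frac{|\mathfrak{v}[x]|}{\mathfrak{a}_\mu[x]},$$ with $$\mathfrak{a}_\mu[x,y]=\mathfrak{a}[x,Jy]-\mu\langle x,Jy\rangle,\qquad x,y\in\mathrm{Dom}[\mathfrak{a}_\mu]=\mathrm{Dom}[\mathfrak{a}].$$
   Context: Inner products and sesquilinear forms are linear in the second argument and antilinear in the first. A sesquilinear form $\mathfrak{s}$ is symmetric if $\mathfrak{s}[x,y]=\overline{\mathfrak{s}[y,x]}$; $\mathfrak{s}[x]:=\mathfrak{s}[x,x]$. A self-adjoint involution is a bounded operator $J$ with $J=J^*$, $J^2=I$. "Positive definite" for the form $\mathfrak{a}_J$ means that it is symmetric with a strictly positive lower bound: there is $c>0$ with $\mathfrak{a}_J[x]\ge c\|x\|^2$ for all $x\in\mathrm{Dom}[\mathfrak{a}]$. Explicitly, $m_\pm=\inf\{\mathfrak{a}_J[x]: x\in\mathfrak{H}_\pm\cap\mathrm{Dom}[\mathfrak{a}],\ \|x\|=1\}$ (equal to $+\infty$ if $\mathfrak{H}_\pm=\{0\}$). A symmetric sesquilinear form $\mathfrak{v}$ on $\mathrm{Dom}[\mathfrak{v}]\supset\mathrm{Dom}[\mathfrak{a}]$ is off-diagonal with respect to $\mathfrak{H}=\mathfrak{H}_+\oplus\mathfrak{H}_-$ if $\mathfrak{v}[Jx,y]=-\mathfrak{v}[x,Jy]$ for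 all $x,y\in\mathrm{Dom}[\mathfrak{a}]$. It is an $\mathfrak{a}$-bounded off-diagonal form if, in addition, $\sup_{0\ne x\in\mathrm{Dom}[\mathfrak{a}]}|\mathfrak{v}[x]|/\mathfrak{a}_J[x]<\infty$. A self-adjoint operator $B$ is associated with a symmetric form $\mathfrak{b}$ if $\mathrm{Dom}(B)\subset\mathrm{Dom}[\mathfrak{b}]$ and $\mathfrak{b}[x,y]=\langle x,By\rangle$ for all $x\in\mathrm{Dom}[\mathfrak{b}]$, $y\in\mathrm{Dom}(B)$. Under the present hypotheses, both $\mathfrak{a}$ and $\mathfrak{a}+\mathfrak{v}$ have a unique associated self-adjoint operator, and the interval $(-m_-,m_+)\ni0$ lies in the resolvent set of each of them. $\mathsf{E}_T(\cdot)$ denotes the spectral measure of a self-adjoint operator $T$, and $\mathbb{R}_+=(0,\infty)$. *)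

theory Defs
  imports "HOL-Analysis.Analysis"
begin

section \<open>Complex Hilbert spaces\<close>

text \<open>The inner product is linear in the second argument; antilinearity in the first one follows
  from \<open>cinner_commute\<close>. Completeness is inherited from \<^class>\<open>banach\<close>.\<close>

class complex_hilbert = banach +
  fixes scaleC :: "complex \<Rightarrow> 'a \<Rightarrow> 'a"  (infixr \<open>*\<^sub>C\<close> 75)
    and cinner :: "'a \<Rightarrow> 'a \<Rightarrow> complex"
  assumes scaleC_add_right: "c *\<^sub>C (x + y) = c *\<^sub>C x + c *\<^sub>C y"
    and scaleC_add_left: "(c + d) *\<^sub>C x = c *\<^sub>C x + d *\<^sub>C x"
    and scaleC_scaleC: "c *\<^sub>C (d *\<^sub>C x) = (c * d) *\<^sub>C x"
    and scaleR_scaleC: "r *\<^sub>R x = complex_of_real r *\<^sub>C x"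
    and cinner_commute: "cinner x y = cnj (cinner y x)"
    and cinner_add_right: "cinner x (y + z) = cinner x y + cinner x z"
    and cinner_scaleC_right: "cinner x (c *\<^sub>C y) = c * cinner x y"
    and cinner_self: "cinner x x = complex_of_real ((norm x)\<^sup>2)"

definition csubspace :: "'a::complex_hilbert set \<Rightarrow> bool" where
  "csubspace D \<longleftrightarrow>
     0 \<in> D \<and> (\<forall>x\<in>D. \<forall>y\<in>D. x + y \<in> D) \<and> (\<forall>c. \<forall>x\<in>D. c *\<^sub>C x \<in> D)"

definition bounded_clinear :: "('a::complex_hilbert \<Rightarrow> 'a) \<Rightarrow> bool" where
  "bounded_clinear T \<longleftrightarrow> bounded_linear T \<and> (\<forall>c x. T (c *\<^sub>C x) = c *\<^sub>C T x)"

definition bounded_self_adjoint :: "('a::complex_hilbert \<Rightarrow> 'a) \<Rightarrow> bool" where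
  "bounded_self_adjoint T \<longleftrightarrow>
     bounded_clinear T \<and> (\<forall>x y. cinner (T x) y = cinner x (T y))"

definition self_adjoint_involution :: "('a::complex_hilbert \<Rightarrow> 'a) \<Rightarrow> bool" where
  "self_adjoint_involution J \<longleftrightarrow> bounded_self_adjoint J \<and> J \<circ> J = id"

definition orthogonal_projection :: "('a::complex_hilbert \<Rightarrow> 'a) \<Rightarrow> bool" where
  "orthogonal_projection P \<longleftrightarrow> bounded_self_adjoint P \<and> P \<circ> P = P"


section \<open>Sesquilinear forms\<close>

text \<open>A form is given by its domain \<open>D\<close> and a function \<open>s\<close> whose values matter only on \<open>D\<close>.\<close>

definition sesquilinear_form ::
    "'a::complex_hilbert set \<Rightarrow> ('a \<Rightarrow> 'a \<Rightarrow> complex) \<Rightarrow> bool" where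
  "sesquilinear_form D s \<longleftrightarrow> csubspace D \<and>
     (\<forall>x\<in>D. \<forall>y\<in>D. \<forall>z\<in>D. s x (y + z) = s x y + s x z \<and> s (x + y) z = s x z + s y z) \<and>
     (\<forall>x\<in>D. \<forall>y\<in>D. \<forall>c. s x (c *\<^sub>C y) = c * s x y \<and> s (c *\<^sub>C x) y = cnj c * s x y)"

definition symmetric_form ::
    "'a::complex_hilbert set \<Rightarrow> ('a \<Rightarrow> 'a \<Rightarrow> complex) \<Rightarrow> bool" where
  "symmetric_form D s \<longleftrightarrow>
     sesquilinear_form D s \<and> (\<forall>x\<in>D. \<forall>y\<in>D. s x y = cnj (s y x))"

definition positive_definite_form ::
    "'a::complex_hilbert set \<Rightarrow> ('a \<Rightarrow> 'a \<Rightarrow> complex) \<Rightarrow> bool" where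
  "positive_definite_form D s \<longleftrightarrow>
     symmetric_form D s \<and> (\<exists>c>0. \<forall>x\<in>D. Re (s x x) \<ge> c * (norm x)\<^sup>2)"

text \<open>Closedness in the sense of Kato: the domain contains the limit of each sequence that
  converges in the Hilbert space and is Cauchy with respect to the form, and the sequence then
  converges to it with respect to the form.\<close>

definition closed_form ::
    "'a::complex_hilbert set \<Rightarrow> ('a \<Rightarrow> 'a \<Rightarrow> complex) \<Rightarrow> bool" where
  "closed_form D s \<longleftrightarrow>
     (\<forall>X x. (\<forall>n::nat. X n \<in> D) \<and> X \<longlonglongrightarrow> x \<and>
        (\<forall>e>0. \<exists>N. \<forall>m\<ge>N. \<forall>n\<ge>N. cmod (s (X m - X n) (X m - X n)) < e)
        \<longrightarrow> x \<in> D \<and> (\<lambda>n. s (X n - x) (X n - x)) \<longlonglongrightarrow> 0)"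

definition form_J ::
    "('a \<Rightarrow> 'a \<Rightarrow> complex) \<Rightarrow> ('a \<Rightarrow> 'a) \<Rightarrow> 'a::complex_hilbert \<Rightarrow> 'a \<Rightarrow> complex" where
  "form_J a J x y = a x (J y)"

definition form_mu ::
    "('a \<Rightarrow> 'a \<Rightarrow> complex) \<Rightarrow> ('a \<Rightarrow> 'a) \<Rightarrow> real \<Rightarrow> 'a::complex_hilbert \<Rightarrow> 'a \<Rightarrow> complex" where
  "form_mu a J \<mu> x y = a x (J y) - complex_of_real \<mu> * cinner x (J y)"

definition H_plus :: "('a \<Rightarrow> 'a) \<Rightarrow> 'a::complex_hilbert set" where
  "H_plus J = range (\<lambda>x. x + J x)"

definition H_minus :: "('a \<Rightarrow> 'a) \<Rightarrow> 'a::complex_hilbert set" where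
  "H_minus J = range (\<lambda>x. x - J x)"

text \<open>The value is \<open>\<infinity>\<close> if \<open>H\<close> contains no unit vector of the domain.\<close>

definition form_lower_bound ::
    "'a::complex_hilbert set \<Rightarrow> ('a \<Rightarrow> 'a \<Rightarrow> complex) \<Rightarrow> 'a set \<Rightarrow> ereal" where
  "form_lower_bound D s H = (INF x\<in>{x \<in> H \<inter> D. norm x = 1}. ereal (Re (s x x)))"

definition off_diagonal ::
    "'a::complex_hilbert set \<Rightarrow> ('a \<Rightarrow> 'a) \<Rightarrow> 'a set \<Rightarrow> ('a \<Rightarrow> 'a \<Rightarrow> complex) \<Rightarrow> bool" where
  "off_diagonal D J Dv v \<longleftrightarrow>
     symmetric_form Dv v \<and> D \<subseteq> Dv \<and> (\<forall>x\<in>D. \<forall>y\<in>D. v (J x) y = - v x (J y))"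

text \<open>On the zero space the supremum is taken over the empty set and equals \<open>-\<infinity>\<close>, which
  \<^const>\<open>real_of_ereal\<close> maps to 0.\<close>

definition relative_bound ::
    "'a::complex_hilbert set \<Rightarrow> ('a \<Rightarrow> 'a \<Rightarrow> complex) \<Rightarrow> ('a \<Rightarrow> 'a \<Rightarrow> complex) \<Rightarrow> ereal" where
  "relative_bound D v s = (SUP x\<in>D - {0}. ereal (cmod (v x x) / Re (s x x)))"

definition bounded_off_diagonal ::
    "'a::complex_hilbert set \<Rightarrow> ('a \<Rightarrow> 'a \<Rightarrow> complex) \<Rightarrow> ('a \<Rightarrow> 'a) \<Rightarrow>
      'a set \<Rightarrow> ('a \<Rightarrow> 'a \<Rightarrow> complex) \<Rightarrow> bool" where
  "bounded_off_diagonal D a J Dv v \<longleftrightarrow>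
     off_diagonal D J Dv v \<and> relative_bound D v (form_J a J) < \<infinity>"

definition optimal_bound ::
    "'a::complex_hilbert set \<Rightarrow> ('a \<Rightarrow> 'a \<Rightarrow> complex) \<Rightarrow> ('a \<Rightarrow> 'a) \<Rightarrow>
      ('a \<Rightarrow> 'a \<Rightarrow> complex) \<Rightarrow> ereal" where
  "optimal_bound D a J v =
     (INF \<mu>\<in>{\<mu>. - form_lower_bound D (form_J a J) (H_minus J) < ereal \<mu> \<and>
               ereal \<mu> < form_lower_bound D (form_J a J) (H_plus J)}.
        relative_bound D v (form_mu a J \<mu>))"


section \<open>Unbounded operators\<close>

text \<open>An unbounded operator is identified with its graph; its domain is \<^const>\<open>Domain\<close>.\<close>

type_synonym 'a unbounded_op = "('a \<times> 'a) set"

definition linear_op :: "'a::complex_hilbert unbounded_op \<Rightarrow> bool" where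
  "linear_op T \<longleftrightarrow> single_valued T \<and> (0, 0) \<in> T \<and>
     (\<forall>x y u w. (x, u) \<in> T \<and> (y, w) \<in> T \<longrightarrow> (x + y, u + w) \<in> T) \<and>
     (\<forall>c x u. (x, u) \<in> T \<longrightarrow> (c *\<^sub>C x, c *\<^sub>C u) \<in> T)"

definition adjoint_op :: "'a::complex_hilbert unbounded_op \<Rightarrow> 'a unbounded_op" where
  "adjoint_op T = {(y, z). \<forall>(x, u)\<in>T. cinner u y = cinner x z}"

definition self_adjoint :: "'a::complex_hilbert unbounded_op \<Rightarrow> bool" where
  "self_adjoint T \<longleftrightarrow> linear_op T \<and> closure (Domain T) = UNIV \<and> adjoint_op T = T"

definition associated_op ::
    "'a::complex_hilbert set \<Rightarrow> ('a \<Rightarrow> 'a \<Rightarrow> complex) \<Rightarrow> 'a unbounded_op \<Rightarrow> bool" where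
  "associated_op D b B \<longleftrightarrow>
     self_adjoint B \<and> Domain B \<subseteq> D \<and> (\<forall>x\<in>D. \<forall>(y, z)\<in>B. b x y = cinner x z)"


section \<open>Spectral measures\<close>

text \<open>Only the values \<open>E S\<close> for Borel sets \<open>S\<close> matter. Countable additivity is with respect to
  strong convergence.\<close>

definition projection_valued_measure ::
    "(real set \<Rightarrow> 'a::complex_hilbert \<Rightarrow> 'a) \<Rightarrow> bool" where
  "projection_valued_measure E \<longleftrightarrow>
     (\<forall>S\<in>sets borel. orthogonal_projection (E S)) \<and>
     E {} = (\<lambda>x. 0) \<and> E UNIV = id \<and>
     (\<forall>S\<in>sets borel. \<forall>T\<in>sets borel. E (S \<inter> T) = E S \<circ> E T) \<and>
     (\<forall>F x. range F \<subseteq> sets borel \<and> disjoint_family F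
        \<longrightarrow> (\<lambda>n::nat. E (F n) x) sums E (\<Union>n. F n) x)"

text \<open>The measure \<open>S \<mapsto> \<langle>x, E(S)x\<rangle>\<close>.\<close>

definition scalar_measure ::
    "(real set \<Rightarrow> 'a::complex_hilbert \<Rightarrow> 'a) \<Rightarrow> 'a \<Rightarrow> real measure" where
  "scalar_measure E x = measure_of UNIV (sets borel) (\<lambda>S. ennreal (Re (cinner x (E S x))))"

text \<open>\<open>T = \<integral> t dE(t)\<close>: the domain consists of all \<open>x\<close> for which \<open>t\<close> is square integrable with
  respect to the scalar measure of \<open>x\<close>, and the quadratic form of \<open>T\<close>, which determines \<open>T\<close> by
  polarization, is given by integrating \<open>t\<close>. The spectral theorem provides, for each self-adjoint
  \<open>T\<close>, such an \<open>E\<close> that is unique on Borel sets.\<close>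

definition spectral_measure_of ::
    "'a::complex_hilbert unbounded_op \<Rightarrow> (real set \<Rightarrow> 'a \<Rightarrow> 'a) \<Rightarrow> bool" where
  "spectral_measure_of T E \<longleftrightarrow> projection_valued_measure E \<and>
     Domain T = {x. (\<integral>\<^sup>+ t. ennreal (t\<^sup>2) \<partial>scalar_measure E x) < \<infinity>} \<and>
     (\<forall>(x, z)\<in>T. cinner x z = complex_of_real (\<integral>t. t \<partial>scalar_measure E x))"

end

(*
  Because Re <Jx, (B - mu)x> = a_mu[x] and |<x, (B - mu)x>| <= sqrt (1 + v_mu^2) a_mu[x], the bounded
  operator S = J - c with c = cos (arctan v_mu) satisfies the Lyapunov inequality
  Re <(B - mu)x, Sx> >= 0.  On the range of Q, where B - mu is positive, the powers of the Cayley
  transform of B - mu tend strongly to 0 while they decrease <y, Sy>; hence <y, Jy> >= c |y|^2 there,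
  and <y, Jy> <= -c |y|^2 on the orthogonal complement by symmetry.  For B = A the constant is c = 1,
  so that P = (I + J)/2, and |(P - Q)x|^2 <= (1 - c)/2 |x|^2 is the half-angle formula.  The same
  argument with c = 0 shows that B has no spectrum between 0 and mu.
*)

theory Submission
  imports Defs
begin

section \<open>The real part of the inner product\<close>

text \<open>Only Re <Bx, Jx> is, and the forms evaluate it because J maps D onto itself. Vectors in
  the range of Q need not lie in Dom(B) either, so the Lyapunov inequality says nothing about them
  directly. The Cayley transform is defined on all of that range, and each of its steps runs through
  a vector of the domain; this is how the inequality reaches every vector of the range. The
  specification of a spectral measure gives only the domain and the quadratic form of the operator,
  so that the operator commutes with its spectral projections has to be derived. The factor sqrt (1
  + v_mu^2), in place of the evident 1 + v_mu, comes from using the relative bound at all vectors s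
  x + r J x: there v[x] is multiplied by s^2 - r^2, while a_mu acquires the cross term 2 s r (a[x] -
  mu |x|^2). Hence a[x] - mu |x|^2 and v[x] cannot both be extremal.\<close>

lemma cinner_add_left:
  "cinner (x + y) z = cinner x z + cinner (y::'a::complex_hilbert) z"
  by (metis cinner_commute cinner_add_right complex_cnj_add)

lemma cinner_scaleC_left: "cinner (c *\<^sub>C x) y = cnj c * cinner x (y::'a::complex_hilbert)"
  by (metis cinner_commute cinner_scaleC_right complex_cnj_mult)

lemma cinner_zero_right [simp]: "cinner x (0::'a::complex_hilbert) = 0"
  using cinner_add_right[of x 0 0] by simp

lemma cinner_zero_left [simp]: "cinner (0::'a::complex_hilbert) x = 0"
  using cinner_add_left[of 0 0 x] by simp

text \<open>All estimates compare real numbers, so the space is treated as a real Hilbert space;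
  complex identities are recovered by testing with x and i x.\<close>

definition rinner :: "'a::complex_hilbert \<Rightarrow> 'a \<Rightarrow> real" where
  "rinner x y = Re (cinner x y)"

lemma rinner_commute: "rinner x y = rinner y x"
  unfolding rinner_def by (subst cinner_commute) simp

lemma rinner_self: "rinner x x = (norm x)\<^sup>2"
  by (simp add: rinner_def cinner_self)

lemma rinner_add_right: "rinner x (y + z) = rinner x y + rinner x z"
  by (simp add: rinner_def cinner_add_right)

lemma rinner_scaleR_right: "rinner x (r *\<^sub>R y) = r * rinner x y"
  by (simp add: rinner_def scaleR_scaleC cinner_scaleC_right)

lemma rinner_add_left: "rinner (x + y) z = rinner x z + rinner y z"
  by (simp add: rinner_def cinner_add_left)

lemma rinner_scaleR_left: "rinner (r *\<^sub>R x) y = r * rinner x y"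
  by (simp add: rinner_def scaleR_scaleC cinner_scaleC_left)

lemma rinner_minus_right: "rinner x (- y) = - rinner x y"
  using rinner_scaleR_right[of x "-1" y] by simp

lemma rinner_minus_left: "rinner (- x) y = - rinner x y"
  using rinner_scaleR_left[of "-1" x y] by simp

lemma rinner_diff_right: "rinner x (y - z) = rinner x y - rinner x z"
  using rinner_add_right[of x y "- z"] by (simp add: rinner_minus_right)

lemma rinner_diff_left: "rinner (x - y) z = rinner x z - rinner y z"
  using rinner_add_left[of x "- y" z] by (simp add: rinner_minus_left)

lemmas rinner_simps = rinner_add_right rinner_add_left rinner_scaleR_right rinner_scaleR_left
  rinner_minus_right rinner_minus_left rinner_diff_right rinner_diff_left

lemma rinner_zero [simp]: "rinner x 0 = 0" "rinner 0 x = 0"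
  by (simp_all add: rinner_def)

lemma norm_add_sq: "(norm (x + y))\<^sup>2 = (norm x)\<^sup>2 + (norm y)\<^sup>2 + 2 * rinner x y"
  unfolding rinner_self[symmetric] using rinner_commute[of x y] by (simp add: rinner_simps)

lemma norm_diff_sq: "(norm (x - y))\<^sup>2 = (norm x)\<^sup>2 + (norm y)\<^sup>2 - 2 * rinner x y"
  unfolding rinner_self[symmetric] using rinner_commute[of x y] by (simp add: rinner_simps)

text \<open>The triangle inequality comes with the norm of the class, so squaring it for x + y and x
  - y gives both signs.\<close>

lemma rinner_Cauchy_Schwarz: "\<bar>rinner x y\<bar> \<le> norm x * norm y"
proof -
  have "(norm (x + y))\<^sup>2 \<le> (norm x + norm y)\<^sup>2"
    by (intro power_mono norm_triangle_ineq norm_ge_zero)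
  moreover have "(norm (x - y))\<^sup>2 \<le> (norm x + norm y)\<^sup>2"
    by (intro power_mono norm_triangle_ineq4 norm_ge_zero)
  ultimately show ?thesis
    by (simp add: norm_add_sq norm_diff_sq power2_sum)
qed

lemma bounded_bilinear_rinner: "bounded_bilinear rinner"
  by standard (auto simp: rinner_simps intro!: exI[of _ 1] rinner_Cauchy_Schwarz)

lemmas tendsto_rinner = bounded_bilinear.tendsto[OF bounded_bilinear_rinner]

text \<open>Antilinearity in the first argument turns the imaginary part of <x, y> into the real
  part of <i x, y>.\<close>

lemma cinner_eq_rinner:
  "cinner x y = complex_of_real (rinner x y) + \<i> * complex_of_real (rinner (\<i> *\<^sub>C x) y)"
  by (simp add: rinner_def cinner_scaleC_left complex_eq_iff)

lemma rinner_eq_0_dense: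
  assumes "closure M = UNIV" "\<And>x. x \<in> M \<Longrightarrow> rinner x y = 0"
  shows "y = 0"
proof -
  obtain X where X: "\<And>n::nat. X n \<in> M" "X \<longlonglongrightarrow> y"
    using assms(1) closure_sequential[of y M] by auto
  have "(\<lambda>n. rinner (X n) y) \<longlonglongrightarrow> rinner y y"
    by (intro tendsto_rinner X tendsto_const)
  then have "rinner y y = 0"
    using assms(2)[OF X(1)] LIMSEQ_unique[OF _ tendsto_const[of 0]] by force
  then show ?thesis by (simp add: rinner_self)
qed

section \<open>Orthogonal projection onto closed real subspaces\<close>

lemma parallelogram:
  "(norm (x - y))\<^sup>2 = 2 * (norm x)\<^sup>2 + 2 * (norm y)\<^sup>2 - 4 * (norm ((1/2) *\<^sub>R (x + y)))\<^sup>2"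
  for x y :: "'a::complex_hilbert"
  by (simp add: power_mult_distrib norm_add_sq norm_diff_sq rinner_simps power_divide field_simps)

text \<open>Minimize the distance to \<open>N\<close>; minimizing sequences are Cauchy by the parallelogram law.\<close>

lemma orthogonal_decomposition:
  fixes N :: "'a::complex_hilbert set"
  assumes "closed N" "0 \<in> N" and add: "\<And>x y. x \<in> N \<Longrightarrow> y \<in> N \<Longrightarrow> x + y \<in> N"
    and scale: "\<And>r x. x \<in> N \<Longrightarrow> r *\<^sub>R x \<in> N"
  obtains n where "n \<in> N" "\<And>x. x \<in> N \<Longrightarrow> rinner x (y - n) = 0"
proof -
  define d where "d = (INF n\<in>N. (norm (y - n))\<^sup>2)"
  have bdd: "bdd_below ((\<lambda>n. (norm (y - n))\<^sup>2) ` N)"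
    by (intro bdd_belowI[of _ 0]) auto
  have low: "d \<le> (norm (y - n))\<^sup>2" if "n \<in> N" for n
    unfolding d_def using bdd that by (rule cINF_lower)
  have "\<exists>n\<in>N. (norm (y - n))\<^sup>2 < d + 1 / real (Suc k)" for k
  proof (rule ccontr)
    assume "\<not> ?thesis"
    then have "d + 1 / real (Suc k) \<le> d"
      unfolding d_def using assms(2) by (intro cINF_greatest) (auto simp: not_less)
    then show False by (simp add: field_simps)
  qed
  then obtain X where X: "\<And>k. X k \<in> N" "\<And>k. (norm (y - X k))\<^sup>2 < d + 1 / real (Suc k)"
    by metis
  have close: "(norm (X k - X l))\<^sup>2 < 2 * (1 / real (Suc k)) + 2 * (1 / real (Suc l))" for k l
  proof -
    have "(1/2) *\<^sub>R (X k + X l) \<in> N" using X(1) add scale by blast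
    then have "d \<le> (norm (y - (1/2) *\<^sub>R (X k + X l)))\<^sup>2" by (rule low)
    also have "y - (1/2) *\<^sub>R (X k + X l) = (1/2) *\<^sub>R ((y - X l) + (y - X k))"
      by (simp add: scaleR_right_distrib scaleR_right_diff_distrib flip: scaleR_add_left)
    finally have "d \<le> (norm ((1/2) *\<^sub>R ((y - X l) + (y - X k))))\<^sup>2" .
    moreover have "(norm (X k - X l))\<^sup>2 = 2 * (norm (y - X l))\<^sup>2 + 2 * (norm (y - X k))\<^sup>2
        - 4 * (norm ((1/2) *\<^sub>R ((y - X l) + (y - X k))))\<^sup>2"
      using parallelogram[of "y - X l" "y - X k"] by simp
    ultimately show ?thesis using X(2)[of k] X(2)[of l] by simp
  qed
  have "Cauchy X"
  proof (rule metric_CauchyI)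
    fix e :: real assume "e > 0"
    then obtain M where M: "real (Suc M) > 4 / e\<^sup>2" "M > 0"
      by (metis reals_Archimedean2 of_nat_Suc less_add_one order_less_trans gr0I lessI zero_less_Suc of_nat_less_iff)
    have "dist (X k) (X l) < e" if "M \<le> k" "M \<le> l" for k l
    proof -
      have "1 / real (Suc k) \<le> 1 / real (Suc M)" "1 / real (Suc l) \<le> 1 / real (Suc M)"
        using that by (auto simp: frac_le)
      then have "(norm (X k - X l))\<^sup>2 < 4 * (1 / real (Suc M))" using close[of k l] by linarith
      also have "\<dots> < e\<^sup>2"
        using M \<open>e > 0\<close> by (simp add: field_simps)
      finally show ?thesis using \<open>e > 0\<close>
        by (simp add: dist_norm power_less_imp_less_base)
    qed
    then show "\<exists>M. \<forall>m\<ge>M. \<forall>n\<ge>M. dist (X m) (X n) < e" by blast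
  qed
  then obtain n where n: "X \<longlonglongrightarrow> n" using Cauchy_convergent convergent_def by blast
  have nN: "n \<in> N" using assms(1) X(1) n closed_sequentially by blast
  have "(\<lambda>k. (norm (y - X k))\<^sup>2) \<longlonglongrightarrow> (norm (y - n))\<^sup>2" by (intro tendsto_intros n)
  moreover have "(\<lambda>k. d + 1 / real (Suc k)) \<longlonglongrightarrow> d + 0"
    by (intro tendsto_add tendsto_const LIMSEQ_Suc[OF lim_1_over_n])
  ultimately have min: "(norm (y - n))\<^sup>2 \<le> d"
    using X(2) by (intro LIMSEQ_le[of "\<lambda>k. (norm (y - X k))\<^sup>2" _ "\<lambda>k. d + 1 / real (Suc k)"]) (auto intro: less_imp_le)
  have "rinner x (y - n) = 0" if "x \<in> N" for x
  proof (rule ccontr)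
    define r where "r = rinner x (y - n)"
    assume "rinner x (y - n) \<noteq> 0"
    then have "r \<noteq> 0" by (simp add: r_def)
    then have "x \<noteq> 0" by (auto simp: r_def)
    \<comment> \<open>The minimizer of t \<mapsto> |y - n - t x|^2, which would come closer to y
      than n does.\<close>
    define s where "s = r / (norm x)\<^sup>2"
    have "n + s *\<^sub>R x \<in> N" using nN that add scale by blast
    then have "(norm (y - n))\<^sup>2 \<le> (norm ((y - n) - s *\<^sub>R x))\<^sup>2"
      using low min by (smt (verit) diff_diff_add)
    also have "\<dots> = (norm (y - n))\<^sup>2 + s\<^sup>2 * (norm x)\<^sup>2 - 2 * s * r"
      unfolding norm_diff_sq[of "y - n" "s *\<^sub>R x"] r_def
      using rinner_commute[of x "y - n"]
      by (simp add: power_mult_distrib rinner_scaleR_right)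
    also have "\<dots> = (norm (y - n))\<^sup>2 - r\<^sup>2 / (norm x)\<^sup>2"
      using \<open>x \<noteq> 0\<close> by (simp add: s_def field_simps power2_eq_square)
    finally show False using \<open>r \<noteq> 0\<close> \<open>x \<noteq> 0\<close> by (simp add: field_simps)
  qed
  with nN show ?thesis using that by blast
qed

section \<open>Self-adjoint operators\<close>

lemma linear_op_lincomb:
  assumes "linear_op T" "(x, u) \<in> T" "(y, w) \<in> T"
  shows "(r *\<^sub>R x + s *\<^sub>R y, r *\<^sub>R u + s *\<^sub>R w) \<in> T"
  using assms unfolding linear_op_def scaleR_scaleC by blast

lemma self_adjointD:
  assumes "self_adjoint T"
  shows "linear_op T" "closure (Domain T) = UNIV"
    "(y, z) \<in> T \<longleftrightarrow> (\<forall>(x, u)\<in>T. cinner u y = cinner x z)"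
  using assms by (auto simp: self_adjoint_def adjoint_op_def set_eq_iff)

text \<open>The graph is a complex subspace, so the real condition at (i x, i u) supplies the
  imaginary part of the condition at (x, u).\<close>

lemma self_adjoint_iff_rinner:
  assumes "self_adjoint T"
  shows "(y, z) \<in> T \<longleftrightarrow> (\<forall>(x, u)\<in>T. rinner u y = rinner x z)"
proof
  assume "(y, z) \<in> T"
  then show "\<forall>(x, u)\<in>T. rinner u y = rinner x z"
    using self_adjointD(3)[OF assms] by (auto simp: rinner_def)
next
  assume *: "\<forall>(x, u)\<in>T. rinner u y = rinner x z"
  have "cinner u y = cinner x z" if "(x, u) \<in> T" for x u
  proof -
    have "(\<i> *\<^sub>C x, \<i> *\<^sub>C u) \<in> T"
      using self_adjointD(1)[OF assms] that by (auto simp: linear_op_def)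
    with * that have "rinner u y = rinner x z" "rinner (\<i> *\<^sub>C u) y = rinner (\<i> *\<^sub>C x) z"
      by blast+
    then show ?thesis unfolding cinner_eq_rinner[of u y] cinner_eq_rinner[of x z] by simp
  qed
  then show "(y, z) \<in> T" using self_adjointD(3)[OF assms] by blast
qed

lemma self_adjoint_symmetric:
  "self_adjoint T \<Longrightarrow> (x, u) \<in> T \<Longrightarrow> (y, z) \<in> T \<Longrightarrow> rinner u y = rinner x z"
  using self_adjoint_iff_rinner by blast

text \<open>The graph is that of an adjoint, hence cut out by equations that are continuous in both
  components.\<close>

lemma self_adjoint_closed_graph:
  assumes T: "self_adjoint T" and X: "\<And>n. (X n, Y n) \<in> T" "X \<longlonglongrightarrow> x" "Y \<longlonglongrightarrow> y"
  shows "(x, y) \<in> T"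
  unfolding self_adjoint_iff_rinner[OF T]
proof clarify
  fix a b assume "(a, b) \<in> T"
  then have "rinner b (X n) = rinner a (Y n)" for n
    using self_adjoint_symmetric[OF T] X(1) by blast
  then have "(\<lambda>n. rinner a (Y n)) \<longlonglongrightarrow> rinner b x"
    using tendsto_rinner[OF tendsto_const X(2), of b] by simp
  then show "rinner b x = rinner a y"
    using tendsto_rinner[OF tendsto_const X(3), of a] LIMSEQ_unique by blast
qed

text \<open>Needed for B - \<mu> and \<mu> - B, which are positive on the two complementary spectral
  subspaces.\<close>

lemma self_adjoint_affine:
  fixes s r :: real
  assumes T: "self_adjoint T" and s: "s \<noteq> 0"
  shows "self_adjoint {(x, s *\<^sub>R z - r *\<^sub>R x) |x z. (x, z) \<in> T}" (is "self_adjoint ?S")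
  unfolding self_adjoint_def
proof (intro conjI)
  have lin: "linear_op T" using T self_adjointD by blast
  show "closure (Domain ?S) = UNIV"
  proof -
    have "Domain ?S = Domain T" by blast
    then show ?thesis using self_adjointD(2)[OF T] by simp
  qed
  have mem: "(x, s *\<^sub>R z - r *\<^sub>R x) \<in> ?S" if "(x, z) \<in> T" for x z using that by blast
  have comm: "c *\<^sub>C (t *\<^sub>R x) = t *\<^sub>R (c *\<^sub>C x)" for c t and x :: 'a
    by (simp add: scaleR_scaleC scaleC_scaleC mult.commute)
  have dist: "c *\<^sub>C (x - y) = c *\<^sub>C x - c *\<^sub>C y" for c and x y :: 'a
    by (metis add_diff_cancel_right' diff_add_cancel scaleC_add_right)
  show "linear_op ?S"
    unfolding linear_op_def
  proof (intro conjI allI impI)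
    show "single_valued ?S"
      using lin unfolding linear_op_def single_valued_def by blast
    have "(0, 0) \<in> T" using lin by (simp add: linear_op_def)
    from mem[OF this] show "(0, 0) \<in> ?S" by simp
  next
    fix x y u w assume "(x, u) \<in> ?S \<and> (y, w) \<in> ?S"
    then obtain a b where ab: "(x, a) \<in> T" "(y, b) \<in> T" "u = s *\<^sub>R a - r *\<^sub>R x" "w = s *\<^sub>R b - r *\<^sub>R y"
      by blast
    then have "(x + y, a + b) \<in> T" using lin unfolding linear_op_def by blast
    from mem[OF this] show "(x + y, u + w) \<in> ?S"
      unfolding ab by (simp add: algebra_simps del: mem_Collect_eq)
  next
    fix c x u assume "(x, u) \<in> ?S"
    then obtain a where a: "(x, a) \<in> T" "u = s *\<^sub>R a - r *\<^sub>R x" by blast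
    then have "(c *\<^sub>C x, c *\<^sub>C a) \<in> T" using lin unfolding linear_op_def by blast
    from mem[OF this] a show "(c *\<^sub>C x, c *\<^sub>C u) \<in> ?S"
      by (simp add: comm dist del: mem_Collect_eq)
  qed
  have adj: "(y, z) \<in> adjoint_op ?S \<longleftrightarrow> (\<forall>(x, u)\<in>T. cinner (s *\<^sub>R u - r *\<^sub>R x) y = cinner x z)" for y z
    unfolding adjoint_op_def by blast
  \<comment> \<open>Moving the affine map to the other side replaces z by its preimage under the
    inverse map, which exists because s is not 0.\<close>
  have eq: "cinner (s *\<^sub>R u - r *\<^sub>R x) y = cinner x z \<longleftrightarrow>
      cinner u y = cinner x ((1/s) *\<^sub>R (z + r *\<^sub>R y))" for x u y z :: 'a
  proof -
    have "cinner (s *\<^sub>R u + (- r) *\<^sub>R x) y = s * cinner u y - r * cinner x y"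
      using cinner_add_left[of "s *\<^sub>R u" "(-r) *\<^sub>R x" y]
      unfolding scaleR_scaleC cinner_scaleC_left by simp
    moreover have "cinner x ((1/s) *\<^sub>R (z + r *\<^sub>R y)) = (cinner x z + r * cinner x y) / s"
      by (simp add: scaleR_scaleC cinner_scaleC_right cinner_add_right divide_inverse mult.commute)
    ultimately show ?thesis using s by (auto simp: field_simps)
  qed
  have "(y, z) \<in> adjoint_op ?S \<longleftrightarrow> (y, (1/s) *\<^sub>R (z + r *\<^sub>R y)) \<in> T" for y z
    unfolding adj eq using self_adjointD(3)[OF T] by blast
  moreover have "(y, (1/s) *\<^sub>R (z + r *\<^sub>R y)) \<in> T \<longleftrightarrow> (y, z) \<in> ?S" for y z
  proof
    assume "(y, (1/s) *\<^sub>R (z + r *\<^sub>R y)) \<in> T"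
    from mem[OF this] show "(y, z) \<in> ?S" using s by (simp del: mem_Collect_eq)
  next
    assume "(y, z) \<in> ?S"
    then show "(y, (1/s) *\<^sub>R (z + r *\<^sub>R y)) \<in> T" using s by auto
  qed
  ultimately show "adjoint_op ?S = ?S" by (auto simp: set_eq_iff simp del: mem_Collect_eq)
qed

text \<open>The commutation Q T \<subseteq> T Q of an unbounded operator with a projection, read on
  the graph.\<close>

definition reduces :: "('a::complex_hilbert \<Rightarrow> 'a) \<Rightarrow> 'a unbounded_op \<Rightarrow> bool" where
  "reduces Q T \<longleftrightarrow> orthogonal_projection Q \<and> (\<forall>(x, z)\<in>T. (Q x, Q z) \<in> T)"

lemma orthogonal_projectionD:
  assumes "orthogonal_projection Q"
  shows "bounded_linear Q" "Q (Q x) = Q x" "rinner (Q x) y = rinner x (Q y)"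
  using assms
  by (auto simp: orthogonal_projection_def bounded_self_adjoint_def bounded_clinear_def rinner_def
      dest: fun_cong)

text \<open>Positivity gives |x| \<le> |x + z| on the graph over the range of Q, so 1 + T has closed
  range there. A vector w of that subspace orthogonal to the range satisfies T w = -w, which
  positivity allows only for w = 0.\<close>

lemma reduced_surjective:
  assumes T: "self_adjoint T" and Q: "reduces Q T"
    and pos: "\<And>x z. (x, z) \<in> T \<Longrightarrow> Q x = x \<Longrightarrow> 0 \<le> rinner x z"
    and y: "Q y = y"
  obtains x z where "(x, z) \<in> T" "Q x = x" "Q z = z" "y = x + z"
proof -
  interpret Q: bounded_linear Q
    using Q orthogonal_projectionD by (auto simp: reduces_def)
  have lin: "linear_op T" using T self_adjointD by blast
  have QT: "(Q x, Q z) \<in> T" if "(x, z) \<in> T" for x z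
    using Q that by (auto simp: reduces_def)
  have Qsym: "rinner (Q x) y = rinner x (Q y)" and Qid: "Q (Q x) = Q x" for x y
    using Q orthogonal_projectionD by (auto simp: reduces_def)
  have Qz: "Q z = z" if "(x, z) \<in> T" "Q x = x" for x z
    using QT[OF that(1)] that lin by (auto simp: linear_op_def single_valued_def)
  define N where "N = {x + z |x z. (x, z) \<in> T \<and> Q x = x}"
  have memN: "x + z \<in> N" if "(x, z) \<in> T" "Q x = x" for x z using that N_def by blast
  have clN: "closed N"
  proof (rule closed_sequential_limits[THEN iffD2], intro allI impI, elim conjE)
    fix Y l assume "\<forall>n. Y n \<in> N" and Yl: "Y \<longlonglongrightarrow> l"
    then have "\<forall>n. \<exists>x z. (x, z) \<in> T \<and> Q x = x \<and> Y n = x + z"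
      unfolding N_def by blast
    then obtain X Z where XZ: "\<And>n. (X n, Z n) \<in> T" "\<And>n. Q (X n) = X n" "\<And>n. Y n = X n + Z n"
      by metis
    have le: "norm (X m - X n) \<le> norm (Y m - Y n)" for m n
    proof -
      have T1: "(X m - X n, Z m - Z n) \<in> T"
        using linear_op_lincomb[OF lin XZ(1)[of m] XZ(1)[of n], of 1 "-1"] by simp
      have "0 \<le> rinner (X m - X n) (Z m - Z n)"
        by (rule pos[OF T1]) (simp add: Q.diff XZ)
      moreover have "Y m - Y n = (X m - X n) + (Z m - Z n)" by (simp add: XZ)
      ultimately have "(norm (X m - X n))\<^sup>2 \<le> (norm (Y m - Y n))\<^sup>2"
        by (simp only: norm_add_sq) simp
      then show ?thesis by (rule power2_le_imp_le) simp
    qed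
    have "Cauchy Y" using Yl by (rule LIMSEQ_imp_Cauchy)
    then have "Cauchy X"
      unfolding Cauchy_def dist_norm by (metis le le_less_trans)
    then obtain x where x: "X \<longlonglongrightarrow> x" using Cauchy_convergent convergent_def by blast
    have z: "Z \<longlonglongrightarrow> l - x" using tendsto_diff[OF Yl x] by (simp add: XZ)
    have "(x, l - x) \<in> T" using self_adjoint_closed_graph[OF T XZ(1) x z] .
    moreover have "Q x = x" using LIMSEQ_unique[OF Q.tendsto[OF x]] x by (simp add: XZ)
    ultimately have "x + (l - x) \<in> N" by (rule memN)
    then show "l \<in> N" by simp
  qed
  have zN: "0 \<in> N"
    using lin memN[of 0 0] by (simp add: linear_op_def Q.zero)
  have addN: "x + y \<in> N" if xy: "x \<in> N" "y \<in> N" for x y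
  proof -
    obtain a b c d where "(a, b) \<in> T" "Q a = a" "x = a + b" "(c, d) \<in> T" "Q c = c" "y = c + d"
      using xy unfolding N_def by blast
    then show ?thesis using linear_op_lincomb[OF lin, of a b c d 1 1] memN[of "a + c" "b + d"]
      by (simp add: Q.add algebra_simps)
  qed
  have scN: "r *\<^sub>R x \<in> N" if x: "x \<in> N" for r x
  proof -
    obtain a b where "(a, b) \<in> T" "Q a = a" "x = a + b"
      using x unfolding N_def by blast
    then show ?thesis using linear_op_lincomb[OF lin, of a b a b r 0] memN[of "r *\<^sub>R a" "r *\<^sub>R b"]
      by (simp add: Q.scaleR scaleR_right_distrib)
  qed
  obtain n where n: "n \<in> N" "\<And>x. x \<in> N \<Longrightarrow> rinner x (y - n) = 0"
    using orthogonal_decomposition[OF clN zN addN scN, of y] by blast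
  define w where "w = y - n"
  obtain x z where xz: "(x, z) \<in> T" "Q x = x" "n = x + z" using n(1) unfolding N_def by blast
  have Qw: "Q w = w" using xz Qz[of x z] y by (simp add: w_def Q.diff Q.add)
  \<comment> \<open>Because Q w = w, orthogonality to the images of vectors fixed by Q is already
    orthogonality to a + b for all (a, b) in T.\<close>
  have "rinner b w = rinner a (- w)" if "(a, b) \<in> T" for a b
  proof -
    have "rinner (Q a + Q b) w = 0"
      using n(2)[of "Q a + Q b"] QT[OF that] Qid unfolding w_def N_def by blast
    then show ?thesis by (simp add: rinner_simps Qsym Qw)
  qed
  then have "(w, - w) \<in> T" using self_adjoint_iff_rinner[OF T] by blast
  from pos[OF this Qw] have "w = 0" by (simp add: rinner_minus_right rinner_self)
  then show ?thesis using that[of x z] xz Qz[of x z] by (simp add: w_def)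
qed

section \<open>The Lyapunov inequality\<close>

text \<open>Iterate the Cayley transform \<open>(1 - T) (1 + T)\<^sup>-\<^sup>1\<close> on the range of \<open>Q\<close>. One step maps
  \<open>x + Tx\<close> to \<open>x - Tx\<close> and decreases \<open>\<langle>y, Sy\<rangle>\<close> by \<open>4 Re \<langle>Tx, Sx\<rangle>\<close>. Since \<open>\<langle>y\<^sub>m, y\<^sub>n\<rangle>\<close> depends only on
  \<open>m + n\<close>, the even and the odd iterates converge, and injectivity of \<open>T\<close> forces the limit 0.\<close>

lemma lyapunov_nonneg:
  assumes T: "self_adjoint T" and Q: "reduces Q T"
    and pos: "\<And>x z. (x, z) \<in> T \<Longrightarrow> Q x = x \<Longrightarrow> 0 \<le> rinner x z"
    and inj: "\<And>x. (x, 0) \<in> T \<Longrightarrow> x = 0"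
    and S: "bounded_linear S" "\<And>x y. rinner (S x) y = rinner x (S y)"
    and lyap: "\<And>x z. (x, z) \<in> T \<Longrightarrow> 0 \<le> rinner z (S x)"
    and y: "Q y = y"
  shows "0 \<le> rinner y (S y)"
proof -
  interpret Q: bounded_linear Q
    using Q orthogonal_projectionD by (auto simp: reduces_def)
  interpret S: bounded_linear S by fact
  define P where "P u u' \<longleftrightarrow> (\<exists>x z. (x, z) \<in> T \<and> u = x + z \<and> u' = x - z)" for u u'
  have step: "\<exists>u'. Q u' = u' \<and> P u u'" if u: "Q u = u" for u
  proof -
    obtain x z where "(x, z) \<in> T" "Q x = x" "Q z = z" "u = x + z"
      using reduced_surjective[OF T Q pos u] by blast
    then have "P u (x - z)" "Q (x - z) = x - z" unfolding P_def by (blast, simp add: Q.diff)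
    then show ?thesis by blast
  qed
  have "\<exists>f. \<forall>n. (Q (f n) = f n \<and> (n = 0 \<longrightarrow> f n = y)) \<and> P (f n) (f (Suc n))"
    by (rule dependent_nat_choice) (use y step in auto)
  then obtain f where f: "\<And>n. Q (f n) = f n" "f 0 = y" "\<And>n. P (f n) (f (Suc n))" by blast
  define X where "X n = (1/2) *\<^sub>R (f n + f (Suc n))" for n
  define Z where "Z n = (1/2) *\<^sub>R (f n - f (Suc n))" for n
  have XZ: "(X n, Z n) \<in> T" "f n = X n + Z n" "f (Suc n) = X n - Z n" for n
  proof -
    obtain x z where *: "(x, z) \<in> T" "f n = x + z" "f (Suc n) = x - z"
      using f(3)[of n] unfolding P_def by blast
    then have "X n = x" "Z n = z"
      by (simp_all add: X_def Z_def scaleR_right_distrib flip: scaleR_add_left)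
    with * show "(X n, Z n) \<in> T" "f n = X n + Z n" "f (Suc n) = X n - Z n" by auto
  qed
  have QX: "Q (X n) = X n" for n by (simp add: X_def Q.scaleR Q.add f)
  \<comment> \<open>The Cayley transform inherits the symmetry of T.\<close>
  have shift: "rinner (f (Suc m)) (f n) = rinner (f m) (f (Suc n))" for m n
    using self_adjoint_symmetric[OF T XZ(1)[of m] XZ(1)[of n]]
    unfolding XZ(3)[of m] XZ(2)[of n] XZ(2)[of m] XZ(3)[of n]
    by (simp add: rinner_simps)
  define g where "g k = rinner (f 0) (f k)" for k
  have g: "rinner (f m) (f n) = g (m + n)" for m n
    by (induction m arbitrary: n) (simp_all add: g_def shift)
  have nf: "(norm (f n))\<^sup>2 = g (n + n)" for n
    by (simp add: g flip: rinner_self)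
  have dec: "(norm (f (Suc n)))\<^sup>2 \<le> (norm (f n))\<^sup>2" for n
    unfolding XZ(3) XZ(2)[of n] norm_diff_sq norm_add_sq
    using pos[OF XZ(1) QX, of n] by simp
  have dec': "decseq (\<lambda>n. (norm (f n))\<^sup>2)" by (rule decseq_SucI) (rule dec)
  obtain L where L: "(\<lambda>n. (norm (f n))\<^sup>2) \<longlonglongrightarrow> L"
    using decseq_convergent[OF dec', of 0] by auto
  \<comment> \<open>With m + n = 2 k the cross term is -2 |f k|^2; one copy of |f k|^2 absorbs |f
    n|^2 and the other is at least L.\<close>
  have Ldiff: "(norm (f m - f n))\<^sup>2 \<le> (norm (f m))\<^sup>2 - L" if "even (m + n)" "m \<le> n" for m n
  proof -
    define k where "k = (m + n) div 2"
    have k: "m + n = k + k" using that(1) unfolding k_def by presburger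
    have "L \<le> (norm (f k))\<^sup>2"
      by (rule decseq_ge[OF dec' L])
    moreover have "(norm (f n))\<^sup>2 \<le> (norm (f k))\<^sup>2"
      using k that(2) by (intro decseqD[OF dec']) auto
    ultimately show ?thesis
      unfolding norm_diff_sq g k using nf[of k] by simp
  qed
  have cauchy: "Cauchy (\<lambda>n. f (2 * n + j))" for j
  proof (rule CauchyI')
    fix e :: real assume e: "e > 0"
    have "eventually (\<lambda>n. (norm (f n))\<^sup>2 < L + e\<^sup>2) sequentially"
      using L e by (intro order_tendstoD) auto
    then obtain M where M: "\<And>n. n \<ge> M \<Longrightarrow> (norm (f n))\<^sup>2 < L + e\<^sup>2"
      by (auto simp: eventually_sequentially)
    have "norm (f (2 * m + j) - f (2 * n + j)) < e" if "m \<ge> M" "n > m" for m n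
    proof -
      have "(norm (f (2 * m + j) - f (2 * n + j)))\<^sup>2 < e\<^sup>2"
        using Ldiff[of "2 * m + j" "2 * n + j"] M[of "2 * m + j"] that by simp
      then show ?thesis using e by (simp add: power_less_imp_less_base)
    qed
    then show "\<exists>M. \<forall>m\<ge>M. \<forall>n>m. dist (f (2 * m + j)) (f (2 * n + j)) < e"
      unfolding dist_norm by blast
  qed
  obtain p where p: "(\<lambda>n. f (2 * n)) \<longlonglongrightarrow> p"
    using cauchy[of 0] by (auto simp: Cauchy_convergent_iff convergent_def)
  obtain q where q: "(\<lambda>n. f (Suc (2 * n))) \<longlonglongrightarrow> q"
    using cauchy[of 1] by (auto simp: Cauchy_convergent_iff convergent_def)
  have p': "(\<lambda>n. f (Suc (Suc (2 * n)))) \<longlonglongrightarrow> p"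
    using LIMSEQ_Suc[OF p] by simp
  have lim: "((1/2) *\<^sub>R (a + b), (1/2) *\<^sub>R (a - b)) \<in> T"
    if "(\<lambda>n. f (h n)) \<longlonglongrightarrow> a" "(\<lambda>n. f (Suc (h n))) \<longlonglongrightarrow> b" for h a b
  proof (rule self_adjoint_closed_graph[OF T])
    show "(X (h n), Z (h n)) \<in> T" for n by (rule XZ)
    show "(\<lambda>n. X (h n)) \<longlonglongrightarrow> (1/2) *\<^sub>R (a + b)" "(\<lambda>n. Z (h n)) \<longlonglongrightarrow> (1/2) *\<^sub>R (a - b)"
      unfolding X_def Z_def by (intro tendsto_intros that)+
  qed
  \<comment> \<open>In the limit one step takes p to q and the next takes q back to p. The graph
    therefore contains (p + q)/2 paired with (p - q)/2 and also with its negative.\<close>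
  note pqT = lim[of "\<lambda>n. 2 * n", OF p q] lim[of "\<lambda>n. Suc (2 * n)", OF q p']
  then have "(1/2) *\<^sub>R (p - q) = (1/2) *\<^sub>R (q - p)"
    using self_adjointD(1)[OF T] unfolding linear_op_def
    by (auto dest: single_valuedD simp: add.commute[of q p] simp del: scaleR_cancel_left)
  then have "p - q = q - p" by simp
  then have "2 *\<^sub>R p = 2 *\<^sub>R q" by (simp add: scaleR_2 algebra_simps)
  then have pq: "p = q" by simp
  with pqT(1) have "(p, 0) \<in> T" by (simp flip: scaleR_2)
  then have "p = 0" by (rule inj)
  define h where "h n = rinner (f n) (S (f n))" for n
  have h_step: "h (Suc n) \<le> h n" for n
  proof -
    have "h n - h (Suc n) = 2 * (rinner (X n) (S (Z n)) + rinner (Z n) (S (X n)))"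
      unfolding h_def XZ(3) XZ(2)[of n] by (simp add: rinner_simps S.add S.diff)
    also have "\<dots> = 4 * rinner (Z n) (S (X n))"
      using S(2)[of "X n" "Z n"] rinner_commute[of "S (X n)" "Z n"] by simp
    finally show ?thesis using lyap[OF XZ(1), of n] by simp
  qed
  have "(\<lambda>n. h (2 * n)) \<longlonglongrightarrow> rinner 0 (S 0)"
    unfolding h_def using p \<open>p = 0\<close> by (intro tendsto_rinner S.tendsto) auto
  moreover have "h (2 * n) \<le> h 0" for n
    using decseqD[OF decseq_SucI[of h, OF h_step], of 0 "2 * n"] by simp
  ultimately have "rinner 0 (S 0) \<le> h 0"
    by (intro LIMSEQ_le_const2) auto
  then show ?thesis by (simp add: h_def f)
qed

section \<open>Reduction by spectral projections\<close>

lemma pvm_projection: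
  "projection_valued_measure E \<Longrightarrow> S \<in> sets borel \<Longrightarrow> orthogonal_projection (E S)"
  by (auto simp: projection_valued_measure_def)

lemma pvm_Int:
  assumes "projection_valued_measure E" "S \<in> sets borel" "T \<in> sets borel"
  shows "E S (E T x) = E (S \<inter> T) x"
  using assms by (simp add: projection_valued_measure_def)

lemma pvm_sums:
  assumes "projection_valued_measure E" "range F \<subseteq> sets borel" "disjoint_family F"
  shows "(\<lambda>n. E (F n) x) sums E (\<Union>n. F n) x"
  using assms unfolding projection_valued_measure_def by blast

lemma pvm_Un:
  assumes E: "projection_valued_measure E" and S: "S \<in> sets borel" "T \<in> sets borel" "S \<inter> T = {}"
  shows "E (S \<union> T) x = E S x + E T x"
proof -
  have emp: "E {} x = 0" using E by (simp add: projection_valued_measure_def)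
  have "(\<lambda>n. E (binaryset S T n) x) sums E (\<Union>n. binaryset S T n) x"
    using S by (intro pvm_sums[OF E])
      (auto simp: range_binaryset_eq disjoint_family_on_def binaryset_def)
  moreover have "(\<lambda>n. E (binaryset S T n) x) sums (E S x + E T x)"
    using sums_finite[of "{0, 1}" "\<lambda>n. E (binaryset S T n) x"] emp by (auto simp: binaryset_def)
  ultimately show ?thesis by (simp add: UN_binaryset_eq sums_iff)
qed

lemma pvm_Compl:
  assumes E: "projection_valued_measure E" and S: "S \<in> sets borel"
  shows "E (- S) x = x - E S x"
proof -
  have "E (S \<union> - S) x = E S x + E (- S) x"
    using S by (intro pvm_Un[OF E]) auto
  moreover have "E UNIV x = x" using E by (simp add: projection_valued_measure_def)
  ultimately show ?thesis by (metis Compl_partition add_diff_cancel_left')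
qed

section \<open>Scalar measures and the action of spectral projections on them\<close>

lemma scalar_measure:
  assumes E: "projection_valued_measure E"
  shows "space (scalar_measure E x) = UNIV" "sets (scalar_measure E x) = sets borel"
    "S \<in> sets borel \<Longrightarrow> emeasure (scalar_measure E x) S = ennreal (rinner x (E S x))"
proof -
  have sa: "sigma_algebra UNIV (sets (borel :: real measure))"
    using sets.sigma_algebra_axioms[of "borel :: real measure"] by simp
  show "space (scalar_measure E x) = UNIV" "sets (scalar_measure E x) = sets borel"
    unfolding scalar_measure_def using sigma_algebra.sigma_sets_eq[OF sa]
    by (auto simp: space_measure_of_conv sets_measure_of_conv)
  \<comment> \<open>\<open>ennreal\<close> truncates negative numbers, so the sums carry over only
    because <x, E S x> is the square of a norm.\<close>
  have nonneg: "0 \<le> rinner x (E S x)" if "S \<in> sets borel" for S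
  proof -
    have "rinner x (E S x) = rinner (E S x) (E S x)"
      using orthogonal_projectionD(2,3)[OF pvm_projection[OF E that]] by simp
    then show ?thesis by (simp add: rinner_self)
  qed
  show "emeasure (scalar_measure E x) S = ennreal (rinner x (E S x))" if S: "S \<in> sets borel"
    unfolding scalar_measure_def rinner_def
  proof (rule emeasure_measure_of_sigma[OF sa])
    have "E {} x = 0" using E by (simp add: projection_valued_measure_def)
    then show "positive (sets borel) (\<lambda>S. ennreal (Re (cinner x (E S x))))"
      by (simp add: positive_def)
    show "countably_additive (sets borel) (\<lambda>S. ennreal (Re (cinner x (E S x))))"
    proof (rule countably_additiveI)
      fix F :: "nat \<Rightarrow> real set"
      assume F: "range F \<subseteq> sets borel" "disjoint_family F"
      have "(\<lambda>n. rinner x (E (F n) x)) sums rinner x (E (\<Union>n. F n) x)"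
        using bounded_linear.sums[OF bounded_bilinear.bounded_linear_right[OF bounded_bilinear_rinner]
          pvm_sums[OF E F]] .
      then show "(\<Sum>n. ennreal (Re (cinner x (E (F n) x)))) = ennreal (Re (cinner x (E (\<Union>(range F)) x)))"
        unfolding rinner_def[symmetric] using nonneg F(1) by (intro suminf_ennreal_eq) auto
    qed
  qed fact
qed

text \<open>Multiplicativity of E turns <E S x, E A (E S x)> into <x, E (S \<inter> A) x>. Thus
  domain and form at E S x become integrals over S with respect to the measure of x.\<close>

lemma scalar_measure_restrict:
  assumes E: "projection_valued_measure E" and S: "S \<in> sets borel"
  shows "scalar_measure E (E S x) = density (scalar_measure E x) (indicator S)"
proof (rule measure_eqI)
  show "sets (scalar_measure E (E S x)) = sets (density (scalar_measure E x) (indicator S))"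
    by (simp add: scalar_measure[OF E])
  fix A assume "A \<in> sets (scalar_measure E (E S x))"
  then have A: "A \<in> sets borel" by (simp add: scalar_measure[OF E])
  have "rinner (E S x) (E A (E S x)) = rinner x (E (S \<inter> A) x)"
    using orthogonal_projectionD(3)[OF pvm_projection[OF E S]] S A
    by (simp add: pvm_Int[OF E] Int_left_commute Int_commute)
  then have "emeasure (scalar_measure E (E S x)) A = emeasure (scalar_measure E x) (S \<inter> A)"
    using S A by (simp add: scalar_measure[OF E])
  also have "\<dots> = (\<integral>\<^sup>+ t. indicator S t * indicator A t \<partial>scalar_measure E x)"
    unfolding indicator_inter_arith[symmetric]
    using S A by (subst nn_integral_indicator) (auto simp: scalar_measure[OF E])
  also have "\<dots> = emeasure (density (scalar_measure E x) (indicator S)) A"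
    using S A by (subst emeasure_density)
      (auto simp: scalar_measure[OF E] measurable_cong_sets[OF scalar_measure(2)[OF E] refl])
  finally show "emeasure (scalar_measure E (E S x)) A = emeasure (density (scalar_measure E x) (indicator S)) A" .
qed

lemma spectral_measure_ofD:
  assumes "spectral_measure_of T E"
  shows "projection_valued_measure E"
    "x \<in> Domain T \<longleftrightarrow> (\<integral>\<^sup>+ t. ennreal (t\<^sup>2) \<partial>scalar_measure E x) < \<infinity>"
    "(x, z) \<in> T \<Longrightarrow> rinner x z = (\<integral>t. t \<partial>scalar_measure E x)"
  using assms by (auto simp: spectral_measure_of_def rinner_def)

lemma spectral_projection_Domain:
  assumes TE: "spectral_measure_of T E" and S: "S \<in> sets borel" and x: "x \<in> Domain T"
  shows "E S x \<in> Domain T"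
proof -
  note E = spectral_measure_ofD(1)[OF TE]
  have "(\<integral>\<^sup>+ t. ennreal (t\<^sup>2) \<partial>scalar_measure E (E S x))
      = (\<integral>\<^sup>+ t. indicator S t * ennreal (t\<^sup>2) \<partial>scalar_measure E x)"
    unfolding scalar_measure_restrict[OF E S]
    using S by (subst nn_integral_density) (auto simp: measurable_cong_sets[OF scalar_measure(2)[OF E] refl])
  also have "\<dots> \<le> (\<integral>\<^sup>+ t. ennreal (t\<^sup>2) \<partial>scalar_measure E x)"
    by (intro nn_integral_mono) (auto simp: indicator_def)
  also have "\<dots> < \<infinity>" using spectral_measure_ofD(2)[OF TE] x by blast
  finally show ?thesis using spectral_measure_ofD(2)[OF TE] by blast
qed

text \<open>The measure is finite, so |t| \<le> 1 + t^2 turns the domain condition into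
  integrability. This has to be secured before integrals are split, as the Bochner integral defaults
  to 0 on non-integrable functions.\<close>

lemma scalar_measure_integrable:
  assumes TE: "spectral_measure_of T E" and x: "x \<in> Domain T"
  shows "integrable (scalar_measure E x) (\<lambda>t. t)" "integrable (scalar_measure E x) (\<lambda>t. c :: real)"
proof -
  note E = spectral_measure_ofD(1)[OF TE]
  have meas: "measurable (scalar_measure E x) borel = (borel_measurable borel :: (real \<Rightarrow> real) set)"
    by (rule measurable_cong_sets[OF scalar_measure(2)[OF E] refl])
  interpret finite_measure "scalar_measure E x"
    by standard (simp add: scalar_measure[OF E])
  show const: "integrable (scalar_measure E x) (\<lambda>t. c :: real)" for c by simp
  have "integrable (scalar_measure E x) (\<lambda>t. t\<^sup>2)"
    using spectral_measure_ofD(2)[OF TE] x by (intro integrableI_bounded) (auto simp: meas)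
  then show "integrable (scalar_measure E x) (\<lambda>t. t)"
  proof (rule Bochner_Integration.integrable_bound[OF Bochner_Integration.integrable_add[OF const[of 1]]])
    show "AE t in scalar_measure E x. norm t \<le> norm (1 + t\<^sup>2)"
    proof (intro AE_I2)
      fix t :: real
      have "0 \<le> (\<bar>t\<bar> - 1)\<^sup>2" "0 \<le> t\<^sup>2" by simp_all
      then show "norm t \<le> norm (1 + t\<^sup>2)" by (simp add: power2_diff del: zero_le_power2)
    qed
  qed (simp add: meas)
qed

lemma spectral_form_restrict:
  assumes TE: "spectral_measure_of T E" and S: "S \<in> sets borel" and xz: "(x, z) \<in> T"
    and y: "(E S x, y) \<in> T"
  shows "rinner (E S x) y = (\<integral>t. indicator S t * t \<partial>scalar_measure E x)"
proof -
  note E = spectral_measure_ofD(1)[OF TE]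
  have "rinner (E S x) y = (\<integral>t. t \<partial>density (scalar_measure E x) (\<lambda>t. ennreal (indicator S t)))"
    using spectral_measure_ofD(3)[OF TE y] scalar_measure_restrict[OF E S] by (simp add: ennreal_indicator)
  also have "\<dots> = (\<integral>t. indicator S t *\<^sub>R t \<partial>scalar_measure E x)"
    using S by (intro integral_density) (auto simp: measurable_cong_sets[OF scalar_measure(2)[OF E] refl])
  finally show ?thesis by simp
qed

text \<open>Splitting the integral over S and its complement shows that the quadratic form of T has
  no cross terms between Q x and y - Q y. Hence T (y - Q y) is orthogonal to every Q x, and by
  symmetry T (Q x) is orthogonal to every y - Q y; density of the domain then gives T Q x = Q T
  x.\<close>

lemma spectral_projection_reduces:
  assumes T: "self_adjoint T" and TE: "spectral_measure_of T E" and S: "S \<in> sets borel"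
  shows "reduces (E S) T"
proof -
  note E = spectral_measure_ofD(1)[OF TE]
  note sym = self_adjoint_symmetric[OF T]
  have lin: "linear_op T" using T self_adjointD by blast
  have Compl: "E (- S) x = x - E S x" for x by (rule pvm_Compl[OF E S])
  note proj = orthogonal_projectionD[OF pvm_projection[OF E S]]
  interpret Q: bounded_linear "E S" by (rule proj)
  have Dom: "\<exists>u. (E S x, u) \<in> T" if "(x, z) \<in> T" for x z
    using spectral_projection_Domain[OF TE S] that by blast
  have decomp: "rinner x z = rinner (E S x) u + rinner (x - E S x) (z - u)"
    if xz: "(x, z) \<in> T" and u: "(E S x, u) \<in> T" for x z u
  proof -
    have "(x - E S x, z - u) \<in> T" using linear_op_lincomb[OF lin xz u, of 1 "-1"] by simp
    then have u': "(E (- S) x, z - u) \<in> T" by (simp add: Compl)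
    have cS: "- S \<in> sets borel" using S by auto
    have int: "integrable (scalar_measure E x) (\<lambda>t. t)"
      using scalar_measure_integrable[OF TE] xz by blast
    have "rinner x z = (\<integral>t. indicator S t * t + indicator (- S) t * t \<partial>scalar_measure E x)"
      unfolding spectral_measure_ofD(3)[OF TE xz]
      by (intro Bochner_Integration.integral_cong refl) (auto simp: indicator_def)
    also have "\<dots> = (\<integral>t. indicator S t * t \<partial>scalar_measure E x) + (\<integral>t. indicator (- S) t * t \<partial>scalar_measure E x)"
      using S integrable_mult_indicator[OF _ int, of S] integrable_mult_indicator[OF _ int, of "- S"]
      by (intro Bochner_Integration.integral_add) (auto simp: scalar_measure[OF E])
    finally show ?thesis
      using spectral_form_restrict[OF TE S xz u] spectral_form_restrict[OF TE cS xz u'] by (simp add: Compl)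
  qed
  \<comment> \<open>\<open>decomp\<close> at the vector E S x + (y - E S y), whose two components
    are known.\<close>
  have orth: "rinner (E S x) (w - q) = 0"
    if xz: "(x, z) \<in> T" "(y, w) \<in> T" "(E S y, q) \<in> T" for x z y w q
  proof -
    obtain u where u: "(E S x, u) \<in> T" using Dom xz(1) by blast
    have y': "(y - E S y, w - q) \<in> T" using linear_op_lincomb[OF lin xz(2,3), of 1 "-1"] by simp
    have sum: "(E S x + (y - E S y), u + (w - q)) \<in> T"
      using linear_op_lincomb[OF lin u y', of 1 1] by simp
    have Esum: "E S (E S x + (y - E S y)) = E S x" by (simp add: Q.add Q.diff proj)
    have "rinner (E S x + (y - E S y)) (u + (w - q)) = rinner (E S x) u + rinner (y - E S y) (w - q)"
      using decomp[OF sum, of u] u by (simp add: Esum)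
    then show ?thesis using sym[OF u y'] rinner_commute[of u "y - E S y"]
      by (simp add: rinner_add_left rinner_add_right)
  qed
  show ?thesis unfolding reduces_def
  proof (intro conjI pvm_projection[OF E S] ballI, clarify)
    fix x z assume xz: "(x, z) \<in> T"
    obtain u where u: "(E S x, u) \<in> T" using Dom xz by blast
    have u': "(x - E S x, z - u) \<in> T" using linear_op_lincomb[OF lin xz u, of 1 "-1"] by simp
    have dense: "closure (Domain T) = UNIV" using self_adjointD[OF T] by blast
    have "E S (z - u) = 0"
    proof (rule rinner_eq_0_dense[OF dense])
      fix y assume "y \<in> Domain T"
      then obtain w where "(y, w) \<in> T" by blast
      from orth[OF this xz u] show "rinner y (E S (z - u)) = 0" by (simp add: proj)
    qed
    moreover have "u - E S u = 0"
    proof (rule rinner_eq_0_dense[OF dense])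
      fix y assume "y \<in> Domain T"
      then obtain w where w: "(y, w) \<in> T" by blast
      obtain q where q: "(E S y, q) \<in> T" using Dom w by blast
      have y': "(y - E S y, w - q) \<in> T" using linear_op_lincomb[OF lin w q, of 1 "-1"] by simp
      have "rinner y (u - E S u) = rinner (y - E S y) u"
        using proj(3)[of y u] by (simp add: rinner_simps)
      also have "\<dots> = rinner (w - q) (E S x)" using sym[OF y' u] by simp
      also have "\<dots> = 0" using orth[OF xz w q] by (simp add: rinner_commute)
      finally show "rinner y (u - E S u) = 0" .
    qed
    ultimately have "E S z = u" by (simp add: Q.diff)
    then show "(E S x, E S z) \<in> T" using u by simp
  qed
qed

lemma spectral_projection_bounds:
  assumes TE: "spectral_measure_of T E" and S: "S \<in> sets borel" and xz: "(x, z) \<in> T" "E S x = x"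
  shows "S \<subseteq> {l..} \<Longrightarrow> l * (norm x)\<^sup>2 \<le> rinner x z" "S \<subseteq> {..l} \<Longrightarrow> rinner x z \<le> l * (norm x)\<^sup>2"
proof -
  note E = spectral_measure_ofD(1)[OF TE]
  let ?M = "scalar_measure E x"
  have int: "integrable ?M (\<lambda>t. t)" "integrable ?M (\<lambda>t. l)"
    using scalar_measure_integrable[OF TE] xz by blast+
  have intS: "integrable ?M (\<lambda>t. indicator S t * t)" "integrable ?M (\<lambda>t. indicator S t * l)"
    using S integrable_mult_indicator[OF _ int(1), of S] integrable_mult_indicator[OF _ int(2), of S]
    by (auto simp: scalar_measure[OF E])
  have "(\<integral>t. indicator S t * l \<partial>?M) = l * measure ?M S"
    using S by (simp add: scalar_measure[OF E])
  also have "measure ?M S = (norm x)\<^sup>2"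
    using S by (simp add: measure_def scalar_measure[OF E] xz rinner_self)
  finally have l: "(\<integral>t. indicator S t * l \<partial>?M) = l * (norm x)\<^sup>2" .
  have z: "rinner x z = (\<integral>t. indicator S t * t \<partial>?M)"
    using spectral_form_restrict[OF TE S xz(1), of z] xz by simp
  show "l * (norm x)\<^sup>2 \<le> rinner x z" if "S \<subseteq> {l..}"
    unfolding z l[symmetric] using that by (intro integral_mono intS) (auto simp: indicator_def)
  show "rinner x z \<le> l * (norm x)\<^sup>2" if "S \<subseteq> {..l}"
    unfolding z l[symmetric] using that by (intro integral_mono intS) (auto simp: indicator_def)
qed

section \<open>Forms and involutions\<close>

lemma symmetric_form_Re_add:
  assumes s: "symmetric_form D s" and D: "x \<in> D" "y \<in> D" "z \<in> D"
  shows "Re (s (x + y) z) = Re (s x z) + Re (s y z)" "Re (s z (x + y)) = Re (s z x) + Re (s z y)"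
proof -
  have "s (x + y) z = s x z + s y z" "s z (x + y) = s z x + s z y"
    using s D unfolding symmetric_form_def sesquilinear_form_def by blast+
  then show "Re (s (x + y) z) = Re (s x z) + Re (s y z)" "Re (s z (x + y)) = Re (s z x) + Re (s z y)"
    by simp_all
qed

lemma symmetric_form_Re_scaleR:
  assumes s: "symmetric_form D s" and D: "x \<in> D" "y \<in> D"
  shows "Re (s (r *\<^sub>R x) y) = r * Re (s x y)" "Re (s x (r *\<^sub>R y)) = r * Re (s x y)"
proof -
  have "s (r *\<^sub>R x) y = cnj (complex_of_real r) * s x y" "s x (r *\<^sub>R y) = complex_of_real r * s x y"
    using s D unfolding symmetric_form_def sesquilinear_form_def scaleR_scaleC by blast+
  then show "Re (s (r *\<^sub>R x) y) = r * Re (s x y)" "Re (s x (r *\<^sub>R y)) = r * Re (s x y)"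
    by simp_all
qed

lemma symmetric_form_Re_commute:
  assumes s: "symmetric_form D s" and D: "x \<in> D" "y \<in> D"
  shows "Re (s x y) = Re (s y x)"
proof -
  have "s x y = cnj (s y x)" using s D unfolding symmetric_form_def by blast
  then show ?thesis by simp
qed

lemmas symmetric_form_Re_simps = symmetric_form_Re_add symmetric_form_Re_scaleR

lemma csubspace_closed:
  assumes "csubspace D"
  shows "0 \<in> D" "x \<in> D \<Longrightarrow> y \<in> D \<Longrightarrow> x + y \<in> D" "x \<in> D \<Longrightarrow> r *\<^sub>R x \<in> D"
    "x \<in> D \<Longrightarrow> y \<in> D \<Longrightarrow> x - y \<in> D"
proof -
  show sc: "r *\<^sub>R x \<in> D" if "x \<in> D" for r x
    using assms that by (simp add: csubspace_def scaleR_scaleC)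
  show add: "x + y \<in> D" if "x \<in> D" "y \<in> D" for x y
    using assms that by (simp add: csubspace_def)
  show "x - y \<in> D" if "x \<in> D" "y \<in> D"
    using add[OF that(1) sc[OF that(2), of "-1"]] by simp
  show "0 \<in> D" using assms by (simp add: csubspace_def)
qed

text \<open>The lower bound may be \<infinity>, so it is used only through real numbers k below
  it.\<close>

lemma form_lower_bound_scaled:
  assumes "symmetric_form D s" "\<And>r y. y \<in> H \<Longrightarrow> r *\<^sub>R y \<in> H"
    and k: "ereal k \<le> form_lower_bound D s H" and y: "y \<in> H" "y \<in> D"
  shows "k * (norm y)\<^sup>2 \<le> Re (s y y)"
proof -
  have sub: "csubspace D" using assms(1) by (simp add: symmetric_form_def sesquilinear_form_def)
  note s = symmetric_form_Re_scaleR[OF assms(1)] and D = csubspace_closed[OF sub]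
  show ?thesis
  proof (cases "y = 0")
    case True
    then show ?thesis using s(1)[OF D(1) D(1), of 0] by simp
  next
    case False
    define u where "u = (1 / norm y) *\<^sub>R y"
    have "u \<in> {x \<in> H \<inter> D. norm x = 1}" using False y assms(2) D(3) by (simp add: u_def)
    then have "ereal k \<le> ereal (Re (s u u))"
      using k unfolding form_lower_bound_def by (metis (no_types, lifting) INF_lower order_trans)
    moreover have "Re (s u u) = Re (s y y) / (norm y)\<^sup>2"
      unfolding u_def using s y D(3) by (simp add: power2_eq_square)
    ultimately show ?thesis using False by (simp add: field_simps)
  qed
qed

text \<open>If the quadratic form \<open>w ((s\<^sup>2 + r\<^sup>2) \<beta> + 2 s r \<alpha>) - (s\<^sup>2 - r\<^sup>2) V\<close> in \<open>(s, r)\<close> is nonnegative, its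
  discriminant gives \<open>V\<^sup>2 \<le> w\<^sup>2 (\<beta>\<^sup>2 - \<alpha>\<^sup>2)\<close>, and the claim is the Cauchy-Schwarz inequality
  for \<open>(\<alpha>, V / w)\<close> and \<open>(1, w)\<close>.\<close>

lemma sector_inequality:
  fixes \<alpha> \<beta> V w :: real
  assumes w: "0 \<le> w" and ab: "\<bar>\<alpha>\<bar> \<le> \<beta>"
    and bound: "\<And>s r. \<bar>(s\<^sup>2 - r\<^sup>2) * V\<bar> \<le> w * ((s\<^sup>2 + r\<^sup>2) * \<beta> + 2 * s * r * \<alpha>)"
  shows "\<bar>\<alpha> + V\<bar> \<le> sqrt (1 + w\<^sup>2) * \<beta>"
proof -
  have b2: "\<alpha>\<^sup>2 \<le> \<beta>\<^sup>2" using ab by (metis abs_le_square_iff abs_of_nonneg abs_ge_zero order_trans)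
  have V0: "\<bar>V\<bar> \<le> w * \<beta>" using bound[of 1 0] by simp
  define p q k where "p = w * \<beta> - \<bar>V\<bar>" and "q = w * \<beta> + \<bar>V\<bar>" and "k = w * \<alpha>"
  have q0: "0 \<le> q" using V0 by (simp add: q_def)
  have pq: "0 \<le> p * s\<^sup>2 + q * r\<^sup>2 + 2 * k * s * r" for s r
  proof -
    have "(s\<^sup>2 - r\<^sup>2) * \<bar>V\<bar> \<le> \<bar>(s\<^sup>2 - r\<^sup>2) * V\<bar>" by (simp add: abs_mult mult_right_mono)
    with bound[of s r] show ?thesis unfolding p_def q_def k_def by (simp add: algebra_simps)
  qed
  have V2: "V\<^sup>2 \<le> w\<^sup>2 * (\<beta>\<^sup>2 - \<alpha>\<^sup>2)"
  proof (cases "q = 0")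
    case True
    then have "V = 0" using V0 by (simp add: q_def)
    then show ?thesis using b2 by simp
  next
    case False
    \<comment> \<open>For fixed s the form is minimal in r at r = -k s / q; the choice s = q clears
      the denominator.\<close>
    have "0 \<le> q * (p * q - k\<^sup>2)" using pq[of q "- k"] by (simp add: algebra_simps power2_eq_square)
    then have "k\<^sup>2 \<le> p * q" using q0 False by (simp add: zero_le_mult_iff)
    then show ?thesis unfolding p_def q_def k_def by (simp add: algebra_simps power2_eq_square)
  qed
  have "(\<alpha> + V)\<^sup>2 \<le> (1 + w\<^sup>2) * \<beta>\<^sup>2"
  proof (cases "w = 0")
    case True
    then show ?thesis using V2 b2 by simp
  next
    case False
    \<comment> \<open>This square is the difference of the two sides of the next inequality.\<close>
    have "0 \<le> (w\<^sup>2 * \<alpha> - V)\<^sup>2" by simp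
    then have "w\<^sup>2 * (\<alpha> + V)\<^sup>2 \<le> (1 + w\<^sup>2) * (w\<^sup>2 * \<alpha>\<^sup>2 + V\<^sup>2)"
      by (simp add: algebra_simps power2_eq_square)
    also have "\<dots> \<le> (1 + w\<^sup>2) * (w\<^sup>2 * \<beta>\<^sup>2)"
      using V2 by (intro mult_left_mono) (auto simp: algebra_simps)
    finally have "w\<^sup>2 * (\<alpha> + V)\<^sup>2 \<le> w\<^sup>2 * ((1 + w\<^sup>2) * \<beta>\<^sup>2)" by (simp add: mult_ac)
    then show ?thesis using False by simp
  qed
  then have "sqrt ((\<alpha> + V)\<^sup>2) \<le> sqrt ((1 + w\<^sup>2) * \<beta>\<^sup>2)" by (rule real_sqrt_le_mono)
  then show ?thesis using ab by (simp add: real_sqrt_mult)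
qed

section \<open>Involutions and forms compatible with them\<close>

locale involution =
  fixes J :: "'a::complex_hilbert \<Rightarrow> 'a"
  assumes involution: "self_adjoint_involution J"
begin

sublocale J: bounded_linear J
  using involution
  by (simp add: self_adjoint_involution_def bounded_self_adjoint_def bounded_clinear_def)

lemma J_J [simp]: "J (J x) = x"
  using involution by (metis self_adjoint_involution_def comp_apply id_apply)

lemma J_sym: "rinner (J x) y = rinner x (J y)"
  using involution by (simp add: self_adjoint_involution_def bounded_self_adjoint_def rinner_def)

lemma J_isometry: "rinner (J x) (J y) = rinner x y"
  by (simp add: J_sym)

lemma norm_J [simp]: "norm (J x) = norm x"
  using J_isometry[of x x] by (simp add: rinner_self)

text \<open>With P = (I + J)/2 one has <y, Jy> = |P y|^2 - |y - P y|^2, the cosine of twice the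
  angle between y and the range of P, times |y|^2. The hypotheses thus bound by half of arctan w the
  angle of the range of Q to that of P, and likewise for the two kernels.\<close>

lemma projection_difference_bound:
  assumes Q: "bounded_linear Q" "\<And>x. Q (Q x) = Q x"
      "\<And>x y. rinner (Q x) y = rinner x (Q y)"
    and w: "0 \<le> w"
    and plus: "\<And>y. Q y = y \<Longrightarrow> cos (arctan w) * (norm y)\<^sup>2 \<le> rinner y (J y)"
    and minus: "\<And>y. Q y = 0 \<Longrightarrow> cos (arctan w) * (norm y)\<^sup>2 \<le> - rinner y (J y)"
  shows "norm ((1/2) *\<^sub>R (x + J x) - Q x) \<le> sin (1/2 * arctan w) * norm x"
proof (rule power2_le_imp_le)
  interpret Q: bounded_linear Q by (rule Q)
  show "0 \<le> sin (1/2 * arctan w) * norm x"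
    using w arctan_ubound[of w] pi_gt_zero
    by (intro mult_nonneg_nonneg sin_ge_zero) (auto simp del: pi_gt_zero)
  define q r where "q = Q x" and "r = x - Q x"
  have x: "x = q + r" by (simp add: q_def r_def)
  have qr: "rinner q r = 0" by (simp add: q_def r_def rinner_diff_right Q)
  have "Q q = q" "Q r = 0" by (simp_all add: q_def r_def Q Q.diff)
  then have lower: "cos (arctan w) * (norm q)\<^sup>2 \<le> rinner q (J q)" "cos (arctan w) * (norm r)\<^sup>2 \<le> - rinner r (J r)"
    using plus minus by blast+
  have norms: "(norm (J q - q))\<^sup>2 = 2 * (norm q)\<^sup>2 - 2 * rinner q (J q)"
    "(norm (J r + r))\<^sup>2 = 2 * (norm r)\<^sup>2 + 2 * rinner r (J r)"
    by (simp_all add: norm_add_sq norm_diff_sq J_sym)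
  \<comment> \<open>The two vectors lie in the eigenspaces of J for -1 and 1.\<close>
  have orth: "rinner (J q - q) (J r + r) = 0"
    by (simp add: rinner_simps J_sym)
  have "(1/2) *\<^sub>R (x + J x) - Q x = (1/2) *\<^sub>R ((J q - q) + (J r + r))"
  proof -
    have "Q x = (1/2) *\<^sub>R (q + q)" by (simp add: q_def flip: scaleR_2)
    then show ?thesis unfolding x J.add by (simp add: algebra_simps)
  qed
  then have "(norm ((1/2) *\<^sub>R (x + J x) - Q x))\<^sup>2 = (1/4) * ((norm (J q - q))\<^sup>2 + (norm (J r + r))\<^sup>2)"
    using norm_add_sq[of "J q - q" "J r + r"] orth by (simp add: power_divide)
  also have "\<dots> \<le> (1/2) * (1 - cos (arctan w)) * ((norm q)\<^sup>2 + (norm r)\<^sup>2)"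
    using lower unfolding norms left_diff_distrib right_diff_distrib distrib_left distrib_right
    by linarith
  also have "(norm q)\<^sup>2 + (norm r)\<^sup>2 = (norm x)\<^sup>2"
    using norm_add_sq[of q r] qr x by simp
  also have "cos (arctan w) = 1 - 2 * (sin (1/2 * arctan w))\<^sup>2"
    using cos_double_sin[of "1/2 * arctan w"] by simp
  finally show "(norm ((1/2) *\<^sub>R (x + J x) - Q x))\<^sup>2 \<le> (sin (1/2 * arctan w) * norm x)\<^sup>2"
    by (simp add: power_mult_distrib)
qed

end

locale involutive_form = involution J
  for J :: "'a::complex_hilbert \<Rightarrow> 'a" +
  fixes D :: "'a::complex_hilbert set" and a :: "'a \<Rightarrow> 'a \<Rightarrow> complex"
  assumes a_sym: "symmetric_form D a" and dense: "closure D = UNIV"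
    and J_image: "J ` D = D"
    and a_J: "\<And>x y. x \<in> D \<Longrightarrow> y \<in> D \<Longrightarrow> a (J x) y = a x (J y)"
    and pos_def: "positive_definite_form D (form_J a J)"
begin

lemma J_in_D: "x \<in> D \<Longrightarrow> J x \<in> D"
  using J_image by blast

lemma csubspace_D: "csubspace D"
  using a_sym by (simp add: symmetric_form_def sesquilinear_form_def)

lemmas D_closed = csubspace_closed[OF csubspace_D]

lemma Re_form_mu: "Re (form_mu a J \<mu> x x) = Re (a x (J x)) - \<mu> * rinner x (J x)"
  by (simp add: form_mu_def rinner_def)

text \<open>a_mu is invariant under J, and its real part at the pair x, J x is the form of A -
  \<mu>. Nonnegativity in (s, r) therefore bounds that form by a_mu.\<close>

lemma Re_form_mu_combination:
  assumes x: "x \<in> D"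
  shows "Re (form_mu a J \<mu> (s *\<^sub>R x + r *\<^sub>R J x) (s *\<^sub>R x + r *\<^sub>R J x)) =
    (s\<^sup>2 + r\<^sup>2) * Re (form_mu a J \<mu> x x) + 2 * s * r * (Re (a x x) - \<mu> * (norm x)\<^sup>2)"
proof -
  note [simp] = x J_in_D[OF x] D_closed
  have "Re (a (J x) (J x)) = Re (a x x)" "Re (a (J x) x) = Re (a x (J x))"
    using a_J[of x "J x"] a_J[of x x] by simp_all
  moreover have "rinner (J x) x = rinner x (J x)" "rinner (J x) (J x) = (norm x)\<^sup>2" "rinner x x = (norm x)\<^sup>2"
    by (simp_all add: J_sym rinner_self)
  ultimately show ?thesis
    unfolding Re_form_mu
    by (simp add: symmetric_form_Re_simps[OF a_sym] J.add J.scaleR rinner_add_left rinner_add_right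
        rinner_scaleR_left rinner_scaleR_right algebra_simps power2_eq_square)
qed

text \<open>On the eigenspaces of J for 1 and -1 the form a_mu is a_J - \<mu> and a_J + \<mu>, and
  there are no cross terms between them.\<close>

lemma form_mu_coercive:
  assumes m: "- form_lower_bound D (form_J a J) (H_minus J) < ereal \<mu>"
      "ereal \<mu> < form_lower_bound D (form_J a J) (H_plus J)"
  obtains \<delta> where "\<delta> > 0" "\<And>x. x \<in> D \<Longrightarrow> \<delta> * (norm x)\<^sup>2 \<le> Re (form_mu a J \<mu> x x)"
proof -
  have sym: "symmetric_form D (form_J a J)" using pos_def by (simp add: positive_definite_form_def)
  \<comment> \<open>Real numbers strictly beyond \<mu> and -\<mu> leave a positive margin even if a
    lower bound is \<infinity>.\<close>
  obtain k where k: "\<mu> < k" "ereal k \<le> form_lower_bound D (form_J a J) (H_plus J)"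
    using ereal_dense2[OF m(2)] by (auto intro: less_imp_le)
  have m': "ereal (- \<mu>) < form_lower_bound D (form_J a J) (H_minus J)"
    using m(1) by (simp add: ereal_uminus_less_reorder flip: uminus_ereal.simps)
  obtain l where l: "- \<mu> < l" "ereal l \<le> form_lower_bound D (form_J a J) (H_minus J)"
    using ereal_dense2[OF m'] by (auto intro: less_imp_le)
  define \<delta> where "\<delta> = min (k - \<mu>) (l + \<mu>)"
  have "\<delta> * (norm x)\<^sup>2 \<le> Re (form_mu a J \<mu> x x)" if x: "x \<in> D" for x
  proof -
    note [simp] = x J_in_D[OF x] D_closed
    define y where "y = (1/2) *\<^sub>R (x + J x)"
    define z where "z = (1/2) *\<^sub>R (x - J x)"
    have yz: "y \<in> D" "z \<in> D" by (simp_all add: y_def z_def)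
    have Jyz: "J y = y" "J z = - z"
      by (simp_all add: y_def z_def J.add J.diff J.scaleR add.commute flip: scaleR_minus_right)
    have "y \<in> H_plus J" "z \<in> H_minus J"
      unfolding H_plus_def H_minus_def y_def z_def
      by (auto simp: J.scaleR scaleR_right_distrib scaleR_right_diff_distrib intro!: image_eqI[of _ _ "(1/2) *\<^sub>R x"])
    moreover have "r *\<^sub>R u \<in> H_plus J" if "u \<in> H_plus J" for r u
      using that unfolding H_plus_def
      by (auto simp: J.scaleR scaleR_right_distrib intro!: image_eqI[of _ _ "r *\<^sub>R _"])
    moreover have "r *\<^sub>R u \<in> H_minus J" if "u \<in> H_minus J" for r u
      using that unfolding H_minus_def
      by (auto simp: J.scaleR scaleR_right_diff_distrib intro!: image_eqI[of _ _ "r *\<^sub>R _"])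
    ultimately have kl: "k * (norm y)\<^sup>2 \<le> Re (form_J a J y y)" "l * (norm z)\<^sup>2 \<le> Re (form_J a J z z)"
      using form_lower_bound_scaled[OF sym _ k(2)] form_lower_bound_scaled[OF sym _ l(2)] yz by blast+
    have xyz: "x = y + z"
      by (simp add: y_def z_def scaleR_right_distrib scaleR_right_diff_distrib flip: scaleR_add_left)
    have orth: "rinner y z = 0"
      using J_sym[of y z] by (simp add: Jyz rinner_minus_right)
    have fm: "Re (form_mu a J \<mu> x x) = Re (form_J a J y y) - \<mu> * (norm y)\<^sup>2 + (Re (form_J a J z z) + \<mu> * (norm z)\<^sup>2)"
    proof -
      have "Re (form_mu a J \<mu> x x) = Re (form_J a J x x) - \<mu> * rinner x (J x)"
        by (simp add: Re_form_mu form_J_def)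
      moreover have "rinner x (J x) = (norm y)\<^sup>2 - (norm z)\<^sup>2"
        unfolding xyz J.add Jyz using orth rinner_commute[of z y]
        by (simp add: rinner_add_left rinner_add_right rinner_diff_right rinner_self)
      \<comment> \<open>Compatibility of a with J makes the two eigenspaces orthogonal for
        a.\<close>
      moreover have "Re (form_J a J y z) = 0"
      proof -
        have "a y (J z) = a (J y) z" using a_J[of y z] yz by simp
        also have "\<dots> = a y z" by (simp add: Jyz)
        finally have "Re (form_J a J y z) = Re (a y z)" by (simp add: form_J_def)
        moreover have "Re (form_J a J z y) = Re (a z y)" by (simp add: form_J_def Jyz)
        moreover have "a z (J y) = a (J z) y" using a_J[of z y] yz by simp
        then have "Re (a z y) = - Re (a z y)"
          using symmetric_form_Re_scaleR(1)[OF a_sym yz(2,1), of "-1"] by (simp add: Jyz)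
        ultimately show ?thesis using symmetric_form_Re_commute[OF a_sym yz] by simp
      qed
      then have "Re (form_J a J x x) = Re (form_J a J y y) + Re (form_J a J z z)"
        unfolding xyz using symmetric_form_Re_simps[OF sym] symmetric_form_Re_commute[OF sym yz] yz D_closed(2)[OF yz] by simp
      ultimately show ?thesis by (simp add: algebra_simps)
    qed
    have "\<delta> * (norm x)\<^sup>2 = \<delta> * (norm y)\<^sup>2 + \<delta> * (norm z)\<^sup>2"
      unfolding xyz norm_add_sq orth by (simp add: algebra_simps)
    also have "\<dots> \<le> (k - \<mu>) * (norm y)\<^sup>2 + (l + \<mu>) * (norm z)\<^sup>2"
      by (intro add_mono mult_right_mono) (auto simp: \<delta>_def)
    finally show ?thesis using kl unfolding fm by (simp add: algebra_simps)
  qed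
  moreover have "\<delta> > 0" using k(1) l(1) by (simp add: \<delta>_def)
  ultimately show ?thesis using that by blast
qed

lemma zero_in_gap:
  "- form_lower_bound D (form_J a J) (H_minus J) < ereal 0"
  "ereal 0 < form_lower_bound D (form_J a J) (H_plus J)"
proof -
  obtain c where c: "c > 0" "\<And>x. x \<in> D \<Longrightarrow> c * (norm x)\<^sup>2 \<le> Re (form_J a J x x)"
    using pos_def by (auto simp: positive_definite_form_def)
  have "ereal c \<le> form_lower_bound D (form_J a J) H" for H
    unfolding form_lower_bound_def using c(2) by (intro INF_greatest) force
  moreover have "ereal 0 < ereal c" using c(1) by simp
  ultimately have *: "ereal 0 < form_lower_bound D (form_J a J) H" for H
    by (meson less_le_trans)
  show "ereal 0 < form_lower_bound D (form_J a J) (H_plus J)" by (rule *)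
  show "- form_lower_bound D (form_J a J) (H_minus J) < ereal 0"
    using *[of "H_minus J"] by (simp add: ereal_uminus_less_reorder zero_ereal_def[symmetric])
qed
end

section \<open>Off-diagonal perturbations\<close>

text \<open>Interpreted with the given v for B and with v = 0 for A, so that both spectral
  projections are handled by the same lemmas.\<close>

locale perturbed_form = involutive_form J D a
  for J :: "'a::complex_hilbert \<Rightarrow> 'a" and D a +
  fixes v :: "'a \<Rightarrow> 'a \<Rightarrow> complex" and T :: "'a unbounded_op" and E
  assumes v_sym: "symmetric_form D v"
    and v_J: "\<And>x y. x \<in> D \<Longrightarrow> y \<in> D \<Longrightarrow> v (J x) y = - v x (J y)"
    and T: "associated_op D (\<lambda>x y. a x y + v x y) T"
    and TE: "spectral_measure_of T E"
begin

lemma sa: "self_adjoint T"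
  using T by (simp add: associated_op_def)

lemma T_in_D: "(x, z) \<in> T \<Longrightarrow> x \<in> D"
  using T by (auto simp: associated_op_def)

lemma T_form: "(x, z) \<in> T \<Longrightarrow> y \<in> D \<Longrightarrow> rinner y z = Re (a y x) + Re (v y x)"
  using T by (fastforce simp: associated_op_def rinner_def simp flip: plus_complex.sel(1))

text \<open>Symmetry and off-diagonality make v[Jx, x] purely imaginary, so the perturbation drops
  out.\<close>

lemma T_form_J:
  assumes "(x, z) \<in> T"
  shows "rinner z (J x) = Re (a x (J x))"
proof -
  have x: "x \<in> D" "J x \<in> D" using T_in_D[OF assms] J_in_D by auto
  have "Re (v (J x) x) = - Re (v x (J x))" using v_J[OF x(1) x(1)] by simp
  then have "Re (v (J x) x) = 0" using symmetric_form_Re_commute[OF v_sym x] by simp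
  then show ?thesis
    using T_form[OF assms x(2)] a_J[OF x(1) x(1)] by (simp add: rinner_commute)
qed

text \<open>Along s x + r J x the terms of v between x and J x cancel and v[Jx] = -v[x], which
  produces the factor s^2 - r^2 required by \<open>sector_inequality\<close>.\<close>

lemma sector_bound:
  assumes "0 \<le> w" and bound: "\<And>x. x \<in> D \<Longrightarrow> cmod (v x x) \<le> w * Re (form_mu a J \<mu> x x)"
    and pos: "\<And>x. x \<in> D \<Longrightarrow> 0 \<le> Re (form_mu a J \<mu> x x)" and x: "x \<in> D"
  shows "\<bar>Re (a x x) + Re (v x x) - \<mu> * (norm x)\<^sup>2\<bar> \<le> sqrt (1 + w\<^sup>2) * Re (form_mu a J \<mu> x x)"
proof -
  note [simp] = x J_in_D[OF x] D_closed
  define \<alpha> where "\<alpha> = Re (a x x) - \<mu> * (norm x)\<^sup>2"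
  have comb: "Re (form_mu a J \<mu> (s *\<^sub>R x + r *\<^sub>R J x) (s *\<^sub>R x + r *\<^sub>R J x)) =
      (s\<^sup>2 + r\<^sup>2) * Re (form_mu a J \<mu> x x) + 2 * s * r * \<alpha>" for s r
    unfolding \<alpha>_def by (rule Re_form_mu_combination[OF x])
  have ge0: "0 \<le> (s\<^sup>2 + r\<^sup>2) * Re (form_mu a J \<mu> x x) + 2 * s * r * \<alpha>" for s r
    using pos[of "s *\<^sub>R x + r *\<^sub>R J x"] unfolding comb by simp
  have "\<bar>\<alpha> + Re (v x x)\<bar> \<le> sqrt (1 + w\<^sup>2) * Re (form_mu a J \<mu> x x)"
  proof (rule sector_inequality[OF assms(1)])
    show "\<bar>\<alpha>\<bar> \<le> Re (form_mu a J \<mu> x x)"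
      using ge0[of 1 1] ge0[of 1 "-1"] by simp
    fix s r
    let ?y = "s *\<^sub>R x + r *\<^sub>R J x"
    have "Re (v (J x) (J x)) = - Re (v x x)" "Re (v (J x) x) = - Re (v x (J x))"
      using v_J[of x "J x"] v_J[of x x] by simp_all
    then have "(s\<^sup>2 - r\<^sup>2) * Re (v x x) = Re (v ?y ?y)"
      by (simp add: symmetric_form_Re_simps[OF v_sym] algebra_simps power2_eq_square)
    then have "\<bar>(s\<^sup>2 - r\<^sup>2) * Re (v x x)\<bar> \<le> cmod (v ?y ?y)"
      using abs_Re_le_cmod by simp
    also have "\<dots> \<le> w * Re (form_mu a J \<mu> ?y ?y)" by (rule bound) simp
    finally show "\<bar>(s\<^sup>2 - r\<^sup>2) * Re (v x x)\<bar>
        \<le> w * ((s\<^sup>2 + r\<^sup>2) * Re (form_mu a J \<mu> x x) + 2 * s * r * \<alpha>)"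
      by (simp add: comb)
  qed
  then show ?thesis by (simp add: \<alpha>_def algebra_simps)
qed

text \<open>Mostly applied with \<open>c = cos (arctan w)\<close>. The choice \<open>c = 0\<close> yields only the sign of
  \<open>\<langle>y, Jy\<rangle>\<close>, but needs no bound on \<open>v\<close> relative to the shifted form.\<close>

lemma reducing_projection_bound:
  fixes \<sigma> :: real
  assumes \<sigma>: "\<sigma> = 1 \<or> \<sigma> = -1" and Q: "reduces Q T"
    and sign: "\<And>x z. (x, z) \<in> T \<Longrightarrow> Q x = x \<Longrightarrow> 0 \<le> \<sigma> * (rinner x z - \<mu> * (norm x)\<^sup>2)"
    and \<delta>: "\<delta> > 0" "\<And>x. x \<in> D \<Longrightarrow> \<delta> * (norm x)\<^sup>2 \<le> Re (form_mu a J \<mu> x x)"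
    and c: "\<And>x. x \<in> D \<Longrightarrow>
        c * \<bar>Re (a x x) + Re (v x x) - \<mu> * (norm x)\<^sup>2\<bar> \<le> Re (form_mu a J \<mu> x x)" "0 \<le> c"
    and y: "Q y = y"
  shows "c * (norm y)\<^sup>2 \<le> \<sigma> * rinner y (J y)"
proof -
  define R where "R = {(x, \<sigma> *\<^sub>R z - (\<sigma> * \<mu>) *\<^sub>R x) |x z. (x, z) \<in> T}"
  define S where "S x = \<sigma> *\<^sub>R J x - c *\<^sub>R x" for x
  have R: "self_adjoint R"
    unfolding R_def using \<sigma> by (intro self_adjoint_affine[OF sa]) auto
  interpret Q: bounded_linear Q
    using Q orthogonal_projectionD by (auto simp: reduces_def)
  have QR: "reduces Q R"
    using Q unfolding reduces_def R_def by (force simp: Q.diff Q.scaleR)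
  have \<sigma>2: "\<sigma> * \<sigma> = 1" using \<sigma> by auto
  have "0 \<le> rinner y (S y)"
  proof (rule lyapunov_nonneg[OF R QR _ _ _ _ _ y])
    show "0 \<le> rinner x u" if xu: "(x, u) \<in> R" "Q x = x" for x u
    proof -
      obtain z where z: "(x, z) \<in> T" "u = \<sigma> *\<^sub>R z - (\<sigma> * \<mu>) *\<^sub>R x" using xu(1) unfolding R_def by auto
      show ?thesis
        using sign[OF z(1) xu(2)]
        by (simp add: z(2) rinner_diff_right rinner_scaleR_right rinner_self right_diff_distrib)
    qed
    show "x = 0" if x0: "(x, 0) \<in> R" for x
    proof -
      obtain z where z: "(x, z) \<in> T" "\<sigma> *\<^sub>R z - (\<sigma> * \<mu>) *\<^sub>R x = 0" using x0 unfolding R_def by auto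
      then have "\<sigma> *\<^sub>R (z - \<mu> *\<^sub>R x) = 0" by (simp add: scaleR_right_diff_distrib)
      then have "z = \<mu> *\<^sub>R x" using \<sigma> by auto
      \<comment> \<open>An eigenvector for \<mu> would make a_mu vanish, against coercivity.\<close>
      then have "Re (form_mu a J \<mu> x x) = 0"
        using T_form_J[OF z(1)] by (simp add: Re_form_mu rinner_scaleR_left)
      then show ?thesis using \<delta>(2)[OF T_in_D[OF z(1)]] \<delta>(1) by (simp add: mult_le_0_iff)
    qed
    show "bounded_linear S"
      unfolding S_def
      by (intro bounded_linear_sub bounded_linear_scaleR_right bounded_linear_compose[OF bounded_linear_scaleR_right] J.bounded_linear_axioms)
    show "rinner (S x) y = rinner x (S y)" for x y
      by (simp add: S_def rinner_simps J_sym)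
    show "0 \<le> rinner u (S x)" if xu: "(x, u) \<in> R" for x u
    proof -
      obtain z where z: "(x, z) \<in> T" "u = \<sigma> *\<^sub>R z - (\<sigma> * \<mu>) *\<^sub>R x" using xu unfolding R_def by auto
      note x = T_in_D[OF z(1)]
      have "rinner u (S x) = \<sigma> * \<sigma> * Re (form_mu a J \<mu> x x)
          - \<sigma> * (c * (Re (a x x) + Re (v x x) - \<mu> * (norm x)\<^sup>2))"
        using T_form_J[OF z(1)] T_form[OF z(1) x] rinner_commute[of z x]
        unfolding z(2) S_def by (simp add: rinner_simps Re_form_mu rinner_self algebra_simps)
      moreover have "\<sigma> * (c * (Re (a x x) + Re (v x x) - \<mu> * (norm x)\<^sup>2))
          \<le> c * \<bar>Re (a x x) + Re (v x x) - \<mu> * (norm x)\<^sup>2\<bar>"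
      proof -
        have "\<sigma> * (c * t) \<le> c * \<bar>t\<bar>" for t
          using \<sigma> mult_left_mono[OF abs_ge_self[of t] c(2)] mult_left_mono[OF abs_ge_minus_self[of t] c(2)]
          by auto
        then show ?thesis .
      qed
      ultimately show ?thesis using c(1)[OF x] by (simp add: \<sigma>2)
    qed
  qed
  then show ?thesis by (simp add: S_def rinner_simps rinner_self)
qed

lemma spectral_projection_reduces': "S \<in> sets borel \<Longrightarrow> reduces (E S) T"
  by (rule spectral_projection_reduces[OF sa TE])

lemma spectral_sign:
  assumes "(x, z) \<in> T" "E S x = x"
  shows "S = {\<mu><..} \<Longrightarrow> 0 \<le> 1 * (rinner x z - \<mu> * (norm x)\<^sup>2)"
    "S = {..\<mu>} \<Longrightarrow> 0 \<le> -1 * (rinner x z - \<mu> * (norm x)\<^sup>2)"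
  using spectral_projection_bounds[OF TE _ assms, of \<mu>] by fastforce+

text \<open>Vectors in the range of \<open>E {\<kappa><..\<mu>}\<close> satisfy \<open>\<langle>y, Jy\<rangle> \<ge> 0\<close> as well as \<open>\<langle>y, Jy\<rangle> \<le> 0\<close>. By
  polarization \<open>Re \<langle>Ty, Jy\<rangle> = 0\<close>, which contradicts the positivity of \<open>a_J\<close> shifted by \<open>\<kappa>\<close>.\<close>

lemma spectral_gap:
  assumes "\<kappa> \<le> \<mu>"
    and d: "d > 0" "\<And>x. x \<in> D \<Longrightarrow> d * (norm x)\<^sup>2 \<le> Re (form_mu a J \<kappa> x x)"
    and e: "e > 0" "\<And>x. x \<in> D \<Longrightarrow> e * (norm x)\<^sup>2 \<le> Re (form_mu a J \<mu> x x)"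
  shows "E {\<kappa><..} = E {\<mu><..}"
proof
  fix x
  note pvm = spectral_measure_ofD(1)[OF TE]
  let ?M = "{\<kappa><..\<mu>}"
  note proj = orthogonal_projectionD[OF pvm_projection[OF pvm, of ?M]]
  interpret M: bounded_linear "E ?M" by (rule proj) simp
  have ge0: "0 \<le> Re (form_mu a J \<kappa> x x)" "0 \<le> Re (form_mu a J \<mu> x x)" if "x \<in> D" for x
    using d(2)[OF that] e(2)[OF that] d(1) e(1)
    by (meson less_imp_le mult_nonneg_nonneg order_trans zero_le_power2)+
  have zero: "rinner y (J y) = 0" if y: "E ?M y = y" for y
  proof -
    have "E {\<kappa><..} (E ?M y) = E ?M y" "E {..\<mu>} (E ?M y) = E ?M y"
      by (auto simp: pvm_Int[OF pvm] intro!: arg_cong[where f = "\<lambda>S. E S y"])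
    then have "E {\<kappa><..} y = y" "E {..\<mu>} y = y" by (simp_all add: y)
    note Ey = this
    have red: "reduces (E {\<kappa><..}) T" "reduces (E {..\<mu>}) T"
      by (rule spectral_projection_reduces', simp)+
    have "0 * (norm y)\<^sup>2 \<le> 1 * rinner y (J y)"
      by (rule reducing_projection_bound[OF _ red(1) spectral_sign(1)[OF _ _ refl] d _ _ Ey(1)])
        (use ge0 in auto)
    moreover have "0 * (norm y)\<^sup>2 \<le> -1 * rinner y (J y)"
      by (rule reducing_projection_bound[OF _ red(2) spectral_sign(2)[OF _ _ refl] e _ _ Ey(2)])
        (use ge0 in auto)
    ultimately show ?thesis by simp
  qed
  have vanish: "E ?M y = 0" if "(y, z) \<in> T" for y z
  proof -
    define u where "u = E ?M y"
    define t where "t = E ?M z"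
    have ut: "(u, t) \<in> T" using spectral_projection_reduces'[of ?M] that by (auto simp: reduces_def u_def t_def)
    have Mu: "E ?M u = u" "E ?M t = t" by (simp_all add: u_def t_def proj)
    have "rinner (u + t) (J (u + t)) = 0" by (rule zero) (simp add: M.add Mu)
    then have "rinner t (J u) = 0"
      using zero[OF Mu(1)] zero[OF Mu(2)] J_sym[of u t] rinner_commute[of "J u" t]
      by (simp add: J.add rinner_add_left rinner_add_right)
    then have "Re (form_mu a J \<kappa> u u) = 0"
      using T_form_J[OF ut] zero[OF Mu(1)] by (simp add: Re_form_mu)
    then show ?thesis using d(2)[OF T_in_D[OF ut]] d(1) by (simp add: mult_le_0_iff u_def)
  qed
  have "E ?M x = 0"
  proof (rule rinner_eq_0_dense)
    show "closure (Domain T) = UNIV" using self_adjointD[OF sa] by blast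
    fix y assume "y \<in> Domain T"
    then have "E ?M y = 0" using vanish by blast
    then show "rinner y (E ?M x) = 0" using proj(3)[of y x] by simp
  qed
  moreover have "E (?M \<union> {\<mu><..}) x = E ?M x + E {\<mu><..} x"
    by (intro pvm_Un[OF pvm]) auto
  moreover have "?M \<union> {\<mu><..} = {\<kappa><..}" using assms(1) by auto
  ultimately show "E {\<kappa><..} x = E {\<mu><..} x" by simp
qed

text \<open>The projection is cut at 0 while the estimates concern T - \<mu>;
  \<open>spectral_gap\<close> identifies the cuts at 0 and \<mu>, whichever is larger.\<close>

lemma spectral_projection_J:
  assumes \<mu>: "- form_lower_bound D (form_J a J) (H_minus J) < ereal \<mu>"
      "ereal \<mu> < form_lower_bound D (form_J a J) (H_plus J)"
    and w: "0 \<le> w" "\<And>x. x \<in> D \<Longrightarrow> cmod (v x x) \<le> w * Re (form_mu a J \<mu> x x)"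
  shows "E {0<..} y = y \<Longrightarrow> cos (arctan w) * (norm y)\<^sup>2 \<le> rinner y (J y)"
    "E {0<..} y = 0 \<Longrightarrow> cos (arctan w) * (norm y)\<^sup>2 \<le> - rinner y (J y)"
proof -
  note pvm = spectral_measure_ofD(1)[OF TE]
  obtain d where d: "d > 0" "\<And>x. x \<in> D \<Longrightarrow> d * (norm x)\<^sup>2 \<le> Re (form_mu a J \<mu> x x)"
    using form_mu_coercive[OF \<mu>] by blast
  obtain e where e: "e > 0" "\<And>x. x \<in> D \<Longrightarrow> e * (norm x)\<^sup>2 \<le> Re (form_mu a J 0 x x)"
    using form_mu_coercive[OF zero_in_gap] by blast
  have Q: "E {0<..} = E {\<mu><..}"
  proof (cases "0 \<le> \<mu>")
    case True
    then show ?thesis by (rule spectral_gap[OF _ e d])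
  next
    case False
    then show ?thesis by (intro spectral_gap[OF _ d e, symmetric]) simp
  qed
  have ge0: "0 \<le> Re (form_mu a J \<mu> x x)" if "x \<in> D" for x
    using d(2)[OF that] d(1) by (meson less_imp_le mult_nonneg_nonneg order_trans zero_le_power2)
  have pos: "0 < 1 + w\<^sup>2" using zero_le_power2[of w] by linarith
  \<comment> \<open>\<open>cos (arctan w)\<close> is 1 / sqrt (1 + w^2), the inverse of the constant
    in \<open>sector_bound\<close>.\<close>
  have c: "cos (arctan w) * \<bar>Re (a x x) + Re (v x x) - \<mu> * (norm x)\<^sup>2\<bar> \<le> Re (form_mu a J \<mu> x x)"
    if "x \<in> D" for x
    using sector_bound[OF w ge0 that] pos by (simp add: cos_arctan field_simps)
  have c0: "0 \<le> cos (arctan w)" by (simp add: cos_arctan)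
  have red: "reduces (E {\<mu><..}) T" "reduces (E {..\<mu>}) T"
    by (rule spectral_projection_reduces', simp)+
  show "cos (arctan w) * (norm y)\<^sup>2 \<le> rinner y (J y)" if "E {0<..} y = y"
    using reducing_projection_bound[OF _ red(1) spectral_sign(1)[OF _ _ refl] d c c0 that[unfolded Q]]
    by simp
  show "cos (arctan w) * (norm y)\<^sup>2 \<le> - rinner y (J y)" if "E {0<..} y = 0"
  proof -
    have "- {\<mu><..} = {..\<mu>}" by auto
    then have y: "E {..\<mu>} y = y" using pvm_Compl[OF pvm, of "{\<mu><..}" y] that by (simp add: Q)
    show ?thesis
      using reducing_projection_bound[OF _ red(2) spectral_sign(2)[OF _ _ refl] d c c0 y] by simp
  qed
qed

end

section \<open>The norm bound and the passage to the infimum over the shifts\<close>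

theorem theorem3p1:
  fixes D Dv :: "'a::complex_hilbert set"
    and a v :: "'a \<Rightarrow> 'a \<Rightarrow> complex"
    and J :: "'a \<Rightarrow> 'a"
    and A B :: "'a unbounded_op"
    and E\<^sub>A E\<^sub>B :: "real set \<Rightarrow> 'a \<Rightarrow> 'a"
  assumes "symmetric_form D a" and "closure D = UNIV"
    and "self_adjoint_involution J" and "J ` D = D"
    and "\<And>x y. x \<in> D \<Longrightarrow> y \<in> D \<Longrightarrow> a (J x) y = a x (J y)"
    and "positive_definite_form D (form_J a J)" and "closed_form D (form_J a J)"
    and "bounded_off_diagonal D a J Dv v"
    and "associated_op D a A"
    and "associated_op D (\<lambda>x y. a x y + v x y) B"
    and "spectral_measure_of A E\<^sub>A" and "spectral_measure_of B E\<^sub>B"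
  shows "onorm (\<lambda>x. E\<^sub>A {0<..} x - E\<^sub>B {0<..} x)
           \<le> sin (1/2 * arctan (real_of_ereal (optimal_bound D a J v)))
       \<and> sin (1/2 * arctan (real_of_ereal (optimal_bound D a J v))) < sqrt 2 / 2"
proof
  interpret involutive_form J D a by unfold_locales fact+
  have Dv: "symmetric_form Dv v" "D \<subseteq> Dv" "\<And>x y. x \<in> D \<Longrightarrow> y \<in> D \<Longrightarrow> v (J x) y = - v x (J y)"
    and finite_bound: "relative_bound D v (form_J a J) < \<infinity>"
    using assms(8) by (auto simp: bounded_off_diagonal_def off_diagonal_def)
  have "symmetric_form D v"
    using Dv(1,2) csubspace_D unfolding symmetric_form_def sesquilinear_form_def by (meson subsetD)
  then interpret B: perturbed_form J D a v B E\<^sub>B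
    using Dv assms by unfold_locales auto
  interpret A: perturbed_form J D a "\<lambda>x y. 0" A E\<^sub>A
    using assms csubspace_D by unfold_locales (auto simp: symmetric_form_def sesquilinear_form_def)
  note pvmA = spectral_measure_ofD(1)[OF assms(11)] and pvmB = spectral_measure_ofD(1)[OF assms(12)]
  note projA = orthogonal_projectionD[OF pvm_projection[OF pvmA, of "{0<..}"], simplified]
  note projB = orthogonal_projectionD[OF pvm_projection[OF pvmB, of "{0<..}"], simplified]
  let ?V = "optimal_bound D a J v"
  \<comment> \<open>The shift 0 is admissible, so the assumed bound of v relative to a_J makes the
    infimum finite.\<close>
  have "form_mu a J 0 = form_J a J" by (intro ext) (simp add: form_mu_def form_J_def)
  then have V_finite: "?V < \<infinity>"
    unfolding optimal_bound_def using finite_bound zero_in_gap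
    by (intro le_less_trans[OF INF_lower[of 0]]) auto
  have P: "E\<^sub>A {0<..} x = (1/2) *\<^sub>R (x + J x)" for x
  proof -
    note J_bound = A.spectral_projection_J[OF zero_in_gap, of 0, simplified]
    have "norm ((1/2) *\<^sub>R (x + J x) - E\<^sub>A {0<..} x) \<le> sin (1/2 * arctan 0) * norm x"
      by (rule projection_difference_bound[OF projA]) (use J_bound in auto)
    then show ?thesis by simp
  qed
  have bound: "onorm (\<lambda>x. E\<^sub>A {0<..} x - E\<^sub>B {0<..} x) \<le> sin (1/2 * arctan w)"
    if \<mu>: "- form_lower_bound D (form_J a J) (H_minus J) < ereal \<mu>"
        "ereal \<mu> < form_lower_bound D (form_J a J) (H_plus J)"
      and w: "0 \<le> w" "relative_bound D v (form_mu a J \<mu>) \<le> ereal w" for \<mu> w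
  proof (rule onorm_bound)
    show "0 \<le> sin (1/2 * arctan w)"
      using w arctan_ubound[of w] pi_gt_zero by (intro sin_ge_zero) (auto simp del: pi_gt_zero)
    obtain d where d: "d > 0" "\<And>x. x \<in> D \<Longrightarrow> d * (norm x)\<^sup>2 \<le> Re (form_mu a J \<mu> x x)"
      using form_mu_coercive[OF \<mu>] by blast
    have vw: "cmod (v x x) \<le> w * Re (form_mu a J \<mu> x x)" if x: "x \<in> D" for x
    proof (cases "x = 0")
      case True
      have "v 0 0 = 0"
        using \<open>symmetric_form D v\<close> D_closed(1) scaleR_scaleC[of 0 0]
        unfolding symmetric_form_def sesquilinear_form_def
        by (metis mult_zero_left of_real_0 scaleR_zero_left)
      then show ?thesis using d(2)[OF x] w(1) True by simp
    next
      case False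
      have "0 < d * (norm x)\<^sup>2" using d(1) False by simp
      then have pos: "0 < Re (form_mu a J \<mu> x x)" using d(2)[OF x] by linarith
      have "ereal (cmod (v x x) / Re (form_mu a J \<mu> x x)) \<le> ereal w"
        using w(2) x False unfolding relative_bound_def by (meson DiffI SUP_upper order_trans singletonD)
      then show ?thesis using pos by (simp add: field_simps)
    qed
    show "norm (E\<^sub>A {0<..} x - E\<^sub>B {0<..} x) \<le> sin (1/2 * arctan w) * norm x" for x
      unfolding P
      by (rule projection_difference_bound[OF projB w(1)])
        (use B.spectral_projection_J[OF \<mu> w(1) vw] in auto)
  qed
  show "onorm (\<lambda>x. E\<^sub>A {0<..} x - E\<^sub>B {0<..} x) \<le> sin (1/2 * arctan (real_of_ereal ?V))"
  proof (cases "D - {0} = {}")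
    \<comment> \<open>The zero space: the suprema are -\<infinity>, which
      \<open>real_of_ereal\<close> sends to 0, so the difference must be shown to have norm at most
      0.\<close>
    case True
    then have "relative_bound D v s = - \<infinity>" for s
      unfolding relative_bound_def True by (simp add: bot_ereal_def)
    then have "?V \<le> - \<infinity>"
      unfolding optimal_bound_def using zero_in_gap by (intro INF_lower2[of 0]) auto
    then have V: "real_of_ereal ?V = 0" by simp
    have "closure D \<subseteq> {0}" using True by (intro closure_minimal) auto
    then have "x = 0" for x :: 'a using assms(2) by auto
    then have "norm (E\<^sub>A {0<..} x - E\<^sub>B {0<..} x) \<le> 0 * norm x" for x
      by (metis mult_zero_left norm_zero order_refl)
    then show ?thesis unfolding V by (auto intro: onorm_bound)
  next
    case False
    then obtain x where x: "x \<in> D" "x \<noteq> 0" by blast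
    have "0 \<le> ?V"
      unfolding optimal_bound_def
    proof (intro INF_greatest, clarify)
      fix \<mu> assume \<mu>: "- form_lower_bound D (form_J a J) (H_minus J) < ereal \<mu>"
        "ereal \<mu> < form_lower_bound D (form_J a J) (H_plus J)"
      then obtain d where "d > 0" "\<And>x. x \<in> D \<Longrightarrow> d * (norm x)\<^sup>2 \<le> Re (form_mu a J \<mu> x x)"
        using form_mu_coercive by blast
      then have "0 \<le> Re (form_mu a J \<mu> x x)"
        using x(1) by (meson less_imp_le mult_nonneg_nonneg order_trans zero_le_power2)
      then have "0 \<le> ereal (cmod (v x x) / Re (form_mu a J \<mu> x x))" by simp
      also have "\<dots> \<le> relative_bound D v (form_mu a J \<mu>)"
        unfolding relative_bound_def using x by (intro SUP_upper) auto
      finally show "0 \<le> relative_bound D v (form_mu a J \<mu>)" .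
    qed
    with V_finite obtain r where r: "?V = ereal r" "0 \<le> r" by (cases ?V) auto
    \<comment> \<open>The infimum over \<mu> need not be attained. Each r + \<epsilon> exceeds the
      bound for some \<mu>, and continuity lets \<epsilon> tend to 0.\<close>
    have le: "onorm (\<lambda>x. E\<^sub>A {0<..} x - E\<^sub>B {0<..} x) \<le> sin (1/2 * arctan (r + \<epsilon>))" if "\<epsilon> > 0" for \<epsilon>
    proof -
      have "?V < ereal (r + \<epsilon>)" using r that by simp
      then obtain \<mu> where "- form_lower_bound D (form_J a J) (H_minus J) < ereal \<mu>"
          "ereal \<mu> < form_lower_bound D (form_J a J) (H_plus J)"
          "relative_bound D v (form_mu a J \<mu>) < ereal (r + \<epsilon>)"
        unfolding optimal_bound_def INF_less_iff by blast
      then show ?thesis using r(2) that by (intro bound) auto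
    qed
    have "((\<lambda>\<epsilon>. sin (1/2 * arctan (r + \<epsilon>))) \<longlongrightarrow> sin (1/2 * arctan (r + 0))) (at_right 0)"
      by (intro tendsto_intros)
    moreover have "\<forall>\<^sub>F \<epsilon> in at_right 0. onorm (\<lambda>x. E\<^sub>A {0<..} x - E\<^sub>B {0<..} x) \<le> sin (1/2 * arctan (r + \<epsilon>))"
      using le by (simp add: eventually_at_right_less eventually_mono[OF eventually_at_right_less])
    ultimately show ?thesis
      using tendsto_lowerbound r(1) by fastforce
  qed
  have "sin (1/2 * arctan t) < sin (pi / 4)" for t
    using arctan_ubound[of t] arctan_lbound[of t] by (intro sin_monotone_2pi) auto
  then show "sin (1/2 * arctan (real_of_ereal ?V)) < sqrt 2 / 2" by (simp add: sin_45)
qed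

end
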